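(* Let $(P_v)_{v\in V}$ be a countable collection of right LCM semigroups and let $P_\Gamma=\bigoplus_{v\in V}P_v$ (the graph product over the complete graph $\Gamma$ on $V$). Let $T:P_\Gamma\to\mathcal{B}(\mathcal{H})$ be a doubly commuting unital contractive representation on a Hilbert space $\mathcal{H}$, and let $T_v:P_v\to\mathcal{B}(\mathcal{H})$ be the restriction of $T$ to $P_v$. Then $T$ has a $\ast$-regular dilation if and only if, for each $v\in V$, $T_v$ has a $\ast$-regular dilation as a representation of $P_v$.
   Context: A unital semigroup $P$ (identity $e$) is right LCM if it is left cancellative ($pa=pb\Rightarrow a=b$) and for all $p,q\in P$ either $pP\cap qP=\emptyset$ or $pP\cap qP=rP$ for some $r\in P$. $\bigoplus_{v\in V}P_v$ is the semigroup of families $(p_v)_{v\in V}$, $p_v\in P_v$, with $p_v=e$ for all but finitely many $v$, under coordinatewise multiplication; it is again right LCM, and each $P_v$ is regarded as a subsemigroup. A unital contractive representation $T:P\to\mathcal{B}(\mathcal{H})$ satisfies $T(e)=I$, $T(pq)=T(p)T(q)$, $\|T(p)\|\le1$. $T:P_\Gamma\to\mathcal{B}(\mathcal{H})$ is doubly commuting if for all $u\ne v$ in $V$, $p\in P_u$, $q\in P_v$, the operator $T_u(p)$ commutes with both $T_v(q)$ and $T_v(q)^*$. For a right LCM semigroup $P$, $p\vee q=\{r\in P:pP\cap qP=rP\}$, and for $s\in pP$, $p^{-1}s$ is the unique $t$ with $pt=s$. A unital contractive representation $T$ of $P$ has a $\ast$-regular dilation if the kernel $K(p,q)=T(p^{-1}s)T(q^{-1}s)^*$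 for any $s\in p\vee q$ (independent of $s$), $K(p,q)=0$ if $p\vee q=\emptyset$, is completely positive definite, i.e. $[K(p_i,p_j)]_{i,j}\ge0$ for all $p_1,\dots,p_n\in P$. *)

theory Defs
  imports "HOL-Analysis.Analysis" "HOL-Algebra.Product_Groups"
begin

section \<open>Complex Hilbert spaces and their bounded operators\<close>

text \<open>
  The underlying real Hilbert space is the library's; its real inner product is the real part
  of the complex one, so both give the same norm. The complex inner product is linear in the
  first argument.
\<close>

class complex_hilbert_space = real_inner + complete_space +
  fixes scaleC :: "complex \<Rightarrow> 'a \<Rightarrow> 'a"
    and cinner :: "'a \<Rightarrow> 'a \<Rightarrow> complex"
  assumes scaleC_add_right: "scaleC c (x + y) = scaleC c x + scaleC c y"
    and scaleC_add_left: "scaleC (c + d) x = scaleC c x + scaleC d x"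
    and scaleC_scaleC: "scaleC c (scaleC d x) = scaleC (c * d) x"
    and scaleC_of_real: "scaleC (complex_of_real r) x = scaleR r x"
    and cinner_commute: "cinner x y = cnj (cinner y x)"
    and cinner_add_left: "cinner (x + y) z = cinner x z + cinner y z"
    and cinner_scaleC_left: "cinner (scaleC c x) y = c * cinner x y"
    and Re_cinner: "Re (cinner x y) = inner x y"
begin

subclass banach ..

end

text \<open>
  Elements of \<open>\<B>(\<H>)\<close> are the complex-linear elements of the library's type of bounded
  real-linear operators; the operator norm is the same.
\<close>

definition clinear_op :: "('h::complex_hilbert_space \<Rightarrow>\<^sub>L 'h) \<Rightarrow> bool" where
  "clinear_op A \<longleftrightarrow>
     (\<forall>c x. blinfun_apply A (scaleC c x) = scaleC c (blinfun_apply A x))"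

text \<open>Intended for complex-linear operators, where existence is the Riesz representation theorem.\<close>

definition adjoint_op ::
    "('h::complex_hilbert_space \<Rightarrow>\<^sub>L 'h) \<Rightarrow> ('h \<Rightarrow>\<^sub>L 'h)" where
  "adjoint_op A =
     (THE B. \<forall>x y. cinner (blinfun_apply A x) y = cinner x (blinfun_apply B y))"

definition commuting_ops ::
    "('h::complex_hilbert_space \<Rightarrow>\<^sub>L 'h) \<Rightarrow> ('h \<Rightarrow>\<^sub>L 'h) \<Rightarrow> bool" where
  "commuting_ops A B \<longleftrightarrow> A o\<^sub>L B = B o\<^sub>L A"

text \<open>Positivity of an operator matrix, viewed as an operator on the direct sum \<open>\<H>\<^sup>n\<close>.\<close>

definition positive_op_matrix ::
    "nat \<Rightarrow> (nat \<Rightarrow> nat \<Rightarrow> 'h::complex_hilbert_space \<Rightarrow>\<^sub>L 'h) \<Rightarrow> bool" where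
  "positive_op_matrix n A \<longleftrightarrow>
     (\<forall>h::nat \<Rightarrow> 'h.
        (\<Sum>i<n. cinner (\<Sum>j<n. blinfun_apply (A i j) (h j)) (h i)) \<in> \<real>\<^sub>\<ge>\<^sub>0)"


section \<open>Right LCM semigroups\<close>

text \<open>The principal right ideal \<open>pP\<close> is the coset \<open>p <# carrier P\<close>.\<close>

locale right_lcm_semigroup = monoid P for P (structure) +
  assumes left_cancel:
    "\<lbrakk>p \<in> carrier P; a \<in> carrier P; b \<in> carrier P; p \<otimes> a = p \<otimes> b\<rbrakk> \<Longrightarrow> a = b"
  and right_lcm:
    "\<lbrakk>p \<in> carrier P; q \<in> carrier P\<rbrakk> \<Longrightarrow>
       (p <# carrier P) \<inter> (q <# carrier P) = {} \<or>
       (\<exists>r\<in>carrier P. (p <# carrier P) \<inter> (q <# carrier P) = r <# carrier P)"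

definition lcm_set :: "('a, 'm) monoid_scheme \<Rightarrow> 'a \<Rightarrow> 'a \<Rightarrow> 'a set" where
  "lcm_set P p q =
     {r \<in> carrier P.
        (p <#\<^bsub>P\<^esub> carrier P) \<inter> (q <#\<^bsub>P\<^esub> carrier P) = r <#\<^bsub>P\<^esub> carrier P}"

text \<open>The element \<open>p\<^sup>-\<^sup>1s\<close>, for \<open>s\<close> in the right ideal generated by \<open>p\<close>.\<close>

definition left_quotient :: "('a, 'm) monoid_scheme \<Rightarrow> 'a \<Rightarrow> 'a \<Rightarrow> 'a" where
  "left_quotient P p s = (THE t. t \<in> carrier P \<and> p \<otimes>\<^bsub>P\<^esub> t = s)"

definition direct_sum_monoid ::
    "'v set \<Rightarrow> ('v \<Rightarrow> ('a, 'm) monoid_scheme) \<Rightarrow> ('v \<Rightarrow> 'a) monoid" where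
  "direct_sum_monoid V P =
     (product_group V P)
       \<lparr>carrier := {x \<in> \<Pi>\<^sub>E v\<in>V. carrier (P v). finite {v \<in> V. x v \<noteq> \<one>\<^bsub>P v\<^esub>}}\<rparr>"

definition summand_embedding ::
    "'v set \<Rightarrow> ('v \<Rightarrow> ('a, 'm) monoid_scheme) \<Rightarrow> 'v \<Rightarrow> 'a \<Rightarrow> ('v \<Rightarrow> 'a)" where
  "summand_embedding V P v p = (\<lambda>w\<in>V. if w = v then p else \<one>\<^bsub>P w\<^esub>)"


section \<open>Contractive representations and regular dilations\<close>

definition unital_contractive_rep ::
    "('a, 'm) monoid_scheme \<Rightarrow> ('a \<Rightarrow> 'h::complex_hilbert_space \<Rightarrow>\<^sub>L 'h) \<Rightarrow> bool" where
  "unital_contractive_rep P T \<longleftrightarrow>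
     (\<forall>p\<in>carrier P. clinear_op (T p) \<and> norm (T p) \<le> 1) \<and>
     T \<one>\<^bsub>P\<^esub> = id_blinfun \<and>
     (\<forall>p\<in>carrier P. \<forall>q\<in>carrier P. T (p \<otimes>\<^bsub>P\<^esub> q) = T p o\<^sub>L T q)"

definition summand_restriction ::
    "'v set \<Rightarrow> ('v \<Rightarrow> ('a, 'm) monoid_scheme) \<Rightarrow>
     (('v \<Rightarrow> 'a) \<Rightarrow> 'h::complex_hilbert_space \<Rightarrow>\<^sub>L 'h) \<Rightarrow> 'v \<Rightarrow> 'a \<Rightarrow> 'h \<Rightarrow>\<^sub>L 'h" where
  "summand_restriction V P T v p = T (summand_embedding V P v p)"

definition doubly_commuting ::
    "'v set \<Rightarrow> ('v \<Rightarrow> ('a, 'm) monoid_scheme) \<Rightarrow>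
     (('v \<Rightarrow> 'a) \<Rightarrow> 'h::complex_hilbert_space \<Rightarrow>\<^sub>L 'h) \<Rightarrow> bool" where
  "doubly_commuting V P T \<longleftrightarrow>
     (\<forall>u\<in>V. \<forall>v\<in>V. u \<noteq> v \<longrightarrow>
        (\<forall>p\<in>carrier (P u). \<forall>q\<in>carrier (P v).
           commuting_ops (summand_restriction V P T u p) (summand_restriction V P T v q) \<and>
           commuting_ops (summand_restriction V P T u p)
             (adjoint_op (summand_restriction V P T v q))))"

text \<open>
  The value does not depend on the chosen \<open>s\<close>: two choices differ by a right factor invertible
  in \<open>P\<close>, which a unital contractive representation maps to a unitary.
\<close>

definition regular_kernel ::
    "('a, 'm) monoid_scheme \<Rightarrow> ('a \<Rightarrow> 'h::complex_hilbert_space \<Rightarrow>\<^sub>L 'h) \<Rightarrow>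
     'a \<Rightarrow> 'a \<Rightarrow> 'h \<Rightarrow>\<^sub>L 'h" where
  "regular_kernel P T p q =
     (if lcm_set P p q = {} then 0
      else let s = (SOME s. s \<in> lcm_set P p q)
           in T (left_quotient P p s) o\<^sub>L adjoint_op (T (left_quotient P q s)))"

definition completely_positive_definite ::
    "'a set \<Rightarrow> ('a \<Rightarrow> 'a \<Rightarrow> 'h::complex_hilbert_space \<Rightarrow>\<^sub>L 'h) \<Rightarrow> bool" where
  "completely_positive_definite S K \<longleftrightarrow>
     (\<forall>n. \<forall>p::nat \<Rightarrow> 'a. (\<forall>i<n. p i \<in> S) \<longrightarrow>
        positive_op_matrix n (\<lambda>i j. K (p i) (p j)))"

definition has_star_regular_dilation ::
    "('a, 'm) monoid_scheme \<Rightarrow> ('a \<Rightarrow> 'h::complex_hilbert_space \<Rightarrow>\<^sub>L 'h) \<Rightarrow> bool" where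
  "has_star_regular_dilation P T \<longleftrightarrow>
     unital_contractive_rep P T \<and>
     completely_positive_definite (carrier P) (regular_kernel P T)"

end

theory Submission
  imports Defs
begin

text \<open>
  Ideals, least common multiples and left quotients in \<open>\<Oplus>P\<^sub>v\<close> are computed coordinatewise, so
  on finitely many arguments the kernel of \<open>T\<close> is a finite product of the kernels of the \<open>T\<^sub>v\<close>,
  whose entries commute because \<open>T\<close> is doubly commuting. It then suffices that the entrywise
  product of two positive operator matrices \<open>A\<close>, \<open>B\<close> with mutually commuting entries is positive.
  Scale \<open>B\<close> to \<open>0 \<le> B \<le> 1\<close>. The Riesz--Nagy iteration \<open>B\<^sub>0 = B\<close>, \<open>B\<^sub>m\<^sub>+\<^sub>1 = B\<^sub>m - B\<^sub>m\<^sup>2\<close>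
  writes \<open>B\<close> as the strong sum of the squares \<open>B\<^sub>m\<^sup>2\<close>, and the entrywise product of \<open>A\<close> with the
  square of a self-adjoint matrix \<open>C\<close> commuting with \<open>A\<close> is
  \<open>\<Sum>\<^sub>k C\<^sub>k\<^sub>i\<^sup>* A\<^sub>i\<^sub>j C\<^sub>k\<^sub>j \<ge> 0\<close>. This avoids square roots of operators. Conversely, \<open>P\<^sub>v\<close> sits in
  the sum and the kernel of \<open>T\<^sub>v\<close> is the restriction of the kernel of \<open>T\<close>.
\<close>

section \<open>Adjoints of operators\<close>

text \<open>The minimiser will be the vector representing \<open>f\<close>. By the parallelogram law
  a minimising sequence is Cauchy, and completeness supplies its limit.\<close>

lemma quadratic_functional_minimum:
  fixes f :: "'a::{real_inner,complete_space} \<Rightarrow> real"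
  assumes f: "bounded_linear f"
  obtains z where "\<And>x. (norm z)\<^sup>2 - 2 * f z \<le> (norm x)\<^sup>2 - 2 * f x"
proof -
  interpret f: bounded_linear f by fact
  define g where "g x = (norm x)\<^sup>2 - 2 * f x" for x
  obtain K where K: "\<And>x. norm (f x) \<le> norm x * K" "K \<ge> 0"
    using f.nonneg_bounded by blast
  \<comment> \<open>Completing the square in \<open>norm x - K\<close> bounds \<open>g\<close> from
    below, so its infimum is finite.\<close>
  have g_lower: "- K\<^sup>2 \<le> g x" for x
  proof -
    have "f x \<le> norm x * K" using K(1)[of x] by auto
    moreover have "0 \<le> (norm x - K)\<^sup>2" by simp
    ultimately show ?thesis unfolding g_def by (simp add: power2_diff)
  qed
  define m where "m = Inf (range g)"
  have bdd: "bdd_below (range g)" using g_lower by (intro bdd_belowI[of _ "- K\<^sup>2"]) auto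
  have m_le: "m \<le> g x" for x unfolding m_def using bdd by (simp add: cInf_lower)
  have "\<exists>x. g x < m + 1 / Suc n" for n :: nat
    using cInf_lessD[of "range g" "m + 1 / Suc n"] unfolding m_def by force
  then obtain X where X: "\<And>n. g (X n) < m + 1 / Suc n" by metis
  \<comment> \<open>In the parallelogram law the linear parts cancel. The midpoint has value at
    least \<open>m\<close>, so two nearly minimal points are close to each other.\<close>
  have parallelogram: "(norm (x - y))\<^sup>2 \<le> 2 * (g x - m) + 2 * (g y - m)" for x y
  proof -
    have "(norm (x - y))\<^sup>2 = 2 * g x + 2 * g y - 4 * g ((1/2) *\<^sub>R (x + y))"
      unfolding g_def f.scaleR f.add power2_norm_eq_inner
      by (simp add: inner_add_left inner_add_right inner_diff_left inner_diff_right
          inner_commute algebra_simps)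
    then show ?thesis using m_le[of "(1/2) *\<^sub>R (x + y)"] by simp
  qed
  have "Cauchy X"
  proof (rule metric_CauchyI)
    fix e :: real assume e: "0 < e"
    obtain N :: nat where N: "4 / e\<^sup>2 < Suc N"
      using reals_Archimedean2[of "4 / e\<^sup>2"] by (metis less_trans lessI of_nat_less_iff)
    have "dist (X i) (X j) < e" if "i \<ge> N" "j \<ge> N" for i j
    proof -
      have "1 / real (Suc i) \<le> 1 / Suc N" "1 / real (Suc j) \<le> 1 / Suc N"
        using that by (simp_all add: frac_le)
      moreover have "s < 4 * c"
        if "a \<le> c" "b \<le> c" "s \<le> 2 * (p - m) + 2 * (q - m)" "p < m + a" "q < m + b"
        for a b c p q s
        using that by simp
      ultimately have "(norm (X i - X j))\<^sup>2 < 4 * (1 / Suc N)"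
        using parallelogram X by blast
      also have "\<dots> < e\<^sup>2" using N e by (simp add: field_simps)
      finally show ?thesis using e unfolding dist_norm by (simp add: power_less_imp_less_base)
    qed
    then show "\<exists>M. \<forall>i\<ge>M. \<forall>j\<ge>M. dist (X i) (X j) < e" by blast
  qed
  then obtain z where z: "X \<longlonglongrightarrow> z" using Cauchy_convergent convergent_def by blast
  have "(\<lambda>n. g (X n)) \<longlonglongrightarrow> g z"
    unfolding g_def by (intro tendsto_intros f.tendsto z)
  moreover have "(\<lambda>n. m + 1 / real (Suc n)) \<longlonglongrightarrow> m + 0"
    by (intro tendsto_intros LIMSEQ_Suc[OF lim_1_over_n])
  ultimately have "g z \<le> m + 0" using X by (intro LIMSEQ_le) (auto intro: less_imp_le)
  with m_le have "g z \<le> g x" for x by (smt (verit))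
  then show ?thesis using that unfolding g_def by blast
qed

text \<open>The first variation at the minimiser vanishes in every direction
  \<open>x\<close>.\<close>

lemma riesz_representation:
  fixes f :: "'a::{real_inner,complete_space} \<Rightarrow> real"
  assumes f: "bounded_linear f"
  obtains z where "\<And>x. f x = inner x z"
proof -
  interpret f: bounded_linear f by fact
  obtain z where z: "\<And>x. (norm z)\<^sup>2 - 2 * f z \<le> (norm x)\<^sup>2 - 2 * f x"
    using quadratic_functional_minimum[OF f] by blast
  have "f x = inner x z" for x
  proof -
    define d where "d = inner x z - f x"
    \<comment> \<open>The extra 1 keeps \<open>a\<close> positive even for \<open>x = 0\<close>.
      Inserting \<open>t = - d / a\<close> into the quadratic inequality then leaves 0 \<le> - d^2 /
      a, which forces \<open>d = 0\<close>.\<close>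
    define a where "a = inner x x + 1"
    have a: "a > 0" unfolding a_def by (simp add: add_nonneg_pos)
    have quad: "0 \<le> t\<^sup>2 * inner x x + 2 * t * d" for t
      using z[of "z + t *\<^sub>R x"] unfolding d_def f.add f.scaleR power2_norm_eq_inner
      by (simp add: inner_add_left inner_add_right inner_commute algebra_simps power2_eq_square)
    have "0 \<le> (- d / a)\<^sup>2 * inner x x + 2 * (- d / a) * d" by (rule quad)
    also have "\<dots> \<le> (- d / a)\<^sup>2 * a + 2 * (- d / a) * d"
      unfolding a_def by (intro add_right_mono mult_left_mono) auto
    also have "\<dots> = - (d\<^sup>2 / a)" using a by (simp add: field_simps power2_eq_square)
    finally have "d\<^sup>2 \<le> 0" using a by (simp add: divide_le_0_iff)
    then show ?thesis unfolding d_def by simp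
  qed
  then show ?thesis using that by blast
qed

text \<open>The imaginary part is recovered from Re (i c) = - Im c and linearity in the first
  argument. Identities for \<open>inner\<close> thus lift to \<open>cinner\<close> once they also
  hold with \<open>scaleC \<i> x\<close> in place of \<open>x\<close>.\<close>

lemma cinner_eq_inner:
  "cinner x y = Complex (inner x y) (- inner (scaleC \<i> x) y)"
proof (rule complex_eqI)
  show "Im (cinner x y) = Im (Complex (inner x y) (- inner (scaleC \<i> x) y))"
    unfolding Re_cinner[symmetric] cinner_scaleC_left complex.sel by simp
  show "Re (cinner x y) = Re (Complex (inner x y) (- inner (scaleC \<i> x) y))"
    unfolding Re_cinner complex.sel ..
qed

lemma inner_ext:
  fixes u v :: "'a::real_inner"
  assumes "\<And>x. inner u x = inner v x"
  shows "u = v"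
proof -
  have "inner (u - v) (u - v) = 0" by (simp add: assms inner_diff_left)
  then show ?thesis by simp
qed

text \<open>The functional x \<mapsto> inner (A x) y is represented for each \<open>y\<close>.
  Uniqueness of representing vectors makes \<open>B\<close> linear, and Cauchy-Schwarz for
  \<open>inner (A (B x)) x\<close> bounds it.\<close>

lemma real_adjoint_exists:
  fixes A :: "'h::complex_hilbert_space \<Rightarrow>\<^sub>L 'h"
  obtains B :: "'h \<Rightarrow>\<^sub>L 'h" where "\<And>x y. inner (A x) y = inner x (B y)"
proof -
  have "\<exists>z. \<forall>x. inner (A x) y = inner x z" for y
  proof -
    have "bounded_linear (\<lambda>x. inner (A x) y)"
      by (intro bounded_linear_compose[OF bounded_linear_inner_left] blinfun.bounded_linear_right)
    then show ?thesis by (rule riesz_representation) blast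
  qed
  then have "\<exists>B. \<forall>y x. inner (A x) y = inner x (B y)" by (intro choice allI)
  then obtain B where B: "\<And>x y. inner (A x) y = inner x (B y)" by blast
  have eqI: "u = v" if "\<And>x. inner x u = inner x v" for u v :: 'h
    by (rule inner_ext) (subst (1 2) inner_commute, rule that)
  have "bounded_linear B"
  proof (rule bounded_linear_intro)
    show "B (x + y) = B x + B y" for x y
      by (rule eqI) (simp add: B[symmetric] inner_add_right)
    show "B (r *\<^sub>R x) = r *\<^sub>R B x" for r x
      by (rule eqI) (simp add: B[symmetric])
    show "norm (B x) \<le> norm x * norm A" for x
    proof (cases "B x = 0")
      case False
      have "norm (B x) * norm (B x) = inner (A (B x)) x"
        unfolding B dot_square_norm power2_eq_square ..
      also have "\<dots> \<le> norm (A (B x)) * norm x" by (rule norm_cauchy_schwarz)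
      also have "\<dots> \<le> (norm A * norm (B x)) * norm x"
        by (intro mult_right_mono norm_blinfun) auto
      finally have "norm (B x) * norm (B x) \<le> norm (B x) * (norm x * norm A)"
        by (simp add: mult_ac)
      then show ?thesis using False by (simp only: mult_le_cancel_left) simp
    qed simp
  qed
  then have "blinfun_apply (Blinfun B) = B" by (rule bounded_linear_Blinfun_apply)
  then show ?thesis using that[of "Blinfun B"] B by simp
qed

lemma adjoint_op_unique:
  fixes A B :: "'h::complex_hilbert_space \<Rightarrow>\<^sub>L 'h"
  assumes "\<And>x y. cinner (A x) y = cinner x (B y)"
  shows "adjoint_op A = B"
  unfolding adjoint_op_def
proof (rule the_equality)
  fix C :: "'h \<Rightarrow>\<^sub>L 'h"
  assume C: "\<forall>x y. cinner (A x) y = cinner x (C y)"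
  have "inner x (C y) = inner x (B y)" for x y
    using C assms by (metis Re_cinner)
  then have "inner (C y - B y) (C y - B y) = 0" for y
    by (simp add: inner_diff_right)
  then show "C = B" by (intro blinfun_eqI) simp
qed (use assms in blast)

text \<open>The real adjoint already works: complex linearity moves \<open>scaleC \<i>\<close>
  through \<open>A\<close>, so the imaginary part is transported just like the real part.\<close>

lemma cinner_adjoint_op:
  assumes A: "clinear_op A"
  shows "cinner (A x) y = cinner x (adjoint_op A y)"
proof -
  obtain B where B: "\<And>x y. inner (A x) y = inner x (blinfun_apply B y)"
    using real_adjoint_exists by blast
  have *: "cinner (A x) y = cinner x (B y)" for x y
    using A by (simp add: cinner_eq_inner clinear_op_def flip: B)
  then show ?thesis using adjoint_op_unique[of A B] by simp
qed

lemma inner_adjoint_op: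
  assumes "clinear_op A"
  shows "inner (A x) y = inner x (adjoint_op A y)"
  using cinner_adjoint_op[OF assms] by (metis Re_cinner)

lemma cinner_adjoint_op_left:
  assumes "clinear_op A"
  shows "cinner (adjoint_op A x) y = cinner x (A y)"
  by (metis assms cinner_adjoint_op cinner_commute)

lemma inner_adjoint_op_left:
  assumes "clinear_op A"
  shows "inner (adjoint_op A x) y = inner x (A y)"
  by (metis assms inner_adjoint_op inner_commute)

lemma adjoint_op_compose:
  assumes "clinear_op A" "clinear_op B"
  shows "adjoint_op (A o\<^sub>L B) = adjoint_op B o\<^sub>L adjoint_op A"
  by (rule adjoint_op_unique) (simp add: cinner_adjoint_op assms)

lemma adjoint_op_id: "adjoint_op id_blinfun = (id_blinfun :: 'h::complex_hilbert_space \<Rightarrow>\<^sub>L 'h)"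
  by (rule adjoint_op_unique) simp

lemma commuting_ops_apply:
  "commuting_ops A B \<longleftrightarrow> (\<forall>x. A (B x) = B (A x))"
  unfolding commuting_ops_def by (metis blinfun_apply_blinfun_compose blinfun_eqI)

lemma commuting_ops_adjoint:
  assumes "clinear_op A" "clinear_op B" "commuting_ops A B"
  shows "commuting_ops (adjoint_op A) (adjoint_op B)"
  using assms(3) unfolding commuting_ops_def
  by (simp only: adjoint_op_compose[OF assms(1,2), symmetric]
      adjoint_op_compose[OF assms(2,1), symmetric])

text \<open>Formally the adjoint of the hypothesis. Testing against vectors and moving
  \<open>A\<close> and \<open>B\<close> across the inner product avoids taking the adjoint of an
  adjoint.\<close>

lemma commuting_ops_adjoint_swap:
  assumes A: "clinear_op A" and B: "clinear_op B" and "commuting_ops A (adjoint_op B)"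
  shows "commuting_ops B (adjoint_op A)"
  unfolding commuting_ops_apply
proof (rule allI, rule inner_ext)
  fix x y
  show "inner (B (adjoint_op A x)) y = inner (adjoint_op A (B x)) y"
    using assms(3) unfolding commuting_ops_apply
    by (simp only: inner_adjoint_op[OF B] inner_adjoint_op_left[OF A])
qed

lemma commuting_ops_sym: "commuting_ops A B \<Longrightarrow> commuting_ops B A"
  by (simp add: commuting_ops_def)

lemma commuting_ops_compose:
  "commuting_ops A C \<Longrightarrow> commuting_ops B C \<Longrightarrow> commuting_ops (A o\<^sub>L B) C"
  by (simp add: commuting_ops_apply)

section \<open>Entrywise products of positive operator matrices\<close>

lemma blinfun_apply_sum: "blinfun_apply (\<Sum>i\<in>I. f i) x = (\<Sum>i\<in>I. blinfun_apply (f i) x)"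
  by (induction I rule: infinite_finite_induct) (simp_all add: blinfun.add_left)

section \<open>Quadratic forms of operator matrices\<close>

definition mat_vec ::
    "'i set \<Rightarrow> ('i \<Rightarrow> 'i \<Rightarrow> 'h::real_inner \<Rightarrow>\<^sub>L 'h) \<Rightarrow> ('i \<Rightarrow> 'h) \<Rightarrow> 'i \<Rightarrow> 'h" where
  "mat_vec I M h i = (\<Sum>j\<in>I. M i j (h j))"

definition vec_inner :: "'i set \<Rightarrow> ('i \<Rightarrow> 'h::real_inner) \<Rightarrow> ('i \<Rightarrow> 'h) \<Rightarrow> real" where
  "vec_inner I h k = (\<Sum>i\<in>I. inner (h i) (k i))"

definition mat_symmetric :: "'i set \<Rightarrow> ('i \<Rightarrow> 'i \<Rightarrow> 'h::real_inner \<Rightarrow>\<^sub>L 'h) \<Rightarrow> bool" where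
  "mat_symmetric I M \<longleftrightarrow> (\<forall>i\<in>I. \<forall>j\<in>I. \<forall>x y. inner (M i j x) y = inner x (M j i y))"

text \<open>Stated for the real inner product; \<open>positive_op_matrix_iff\<close> identifies it
  with complex positivity for Hermitian matrices. Vectors are total functions, but only their values
  on \<open>I\<close> enter.\<close>

definition mat_nonneg :: "'i set \<Rightarrow> ('i \<Rightarrow> 'i \<Rightarrow> 'h::real_inner \<Rightarrow>\<^sub>L 'h) \<Rightarrow> bool" where
  "mat_nonneg I M \<longleftrightarrow> (\<forall>h. 0 \<le> vec_inner I (mat_vec I M h) h)"

text \<open>Only the upper bound M \<le> 1 in the order of quadratic forms; with symmetry and
  \<open>mat_nonneg\<close> it describes 0 \<le> M \<le> 1.\<close>

definition mat_contractive :: "'i set \<Rightarrow> ('i \<Rightarrow> 'i \<Rightarrow> 'h::real_inner \<Rightarrow>\<^sub>L 'h) \<Rightarrow> bool" where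
  "mat_contractive I M \<longleftrightarrow> (\<forall>h. vec_inner I (mat_vec I M h) h \<le> vec_inner I h h)"

lemma vec_inner_diff_left:
  "vec_inner I (\<lambda>i. h i - h' i) k = vec_inner I h k - vec_inner I h' k"
  unfolding vec_inner_def by (simp add: inner_diff_left sum_subtractf)

lemma vec_inner_diff_right:
  "vec_inner I k (\<lambda>i. h i - h' i) = vec_inner I k h - vec_inner I k h'"
  unfolding vec_inner_def by (simp add: inner_diff_right sum_subtractf)

lemma vec_inner_self_nonneg: "0 \<le> vec_inner I h h"
  unfolding vec_inner_def by (intro sum_nonneg) simp

lemma mat_vec_diff: "mat_vec I M (\<lambda>i. h i - h' i) = (\<lambda>i. mat_vec I M h i - mat_vec I M h' i)"
  unfolding mat_vec_def by (simp add: blinfun.diff_right sum_subtractf)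

lemma mat_symmetric_vec_inner:
  assumes "mat_symmetric I M"
  shows "vec_inner I (mat_vec I M h) k = vec_inner I h (mat_vec I M k)"
proof -
  have "vec_inner I (mat_vec I M h) k = (\<Sum>i\<in>I. \<Sum>j\<in>I. inner (M i j (h j)) (k i))"
    unfolding vec_inner_def mat_vec_def by (simp add: inner_sum_left)
  also have "\<dots> = (\<Sum>i\<in>I. \<Sum>j\<in>I. inner (h j) (M j i (k i)))"
    using assms unfolding mat_symmetric_def by (intro sum.cong) auto
  also have "\<dots> = (\<Sum>j\<in>I. \<Sum>i\<in>I. inner (h j) (M j i (k i)))"
    by (rule sum.swap)
  also have "\<dots> = vec_inner I h (mat_vec I M k)"
    unfolding vec_inner_def mat_vec_def by (simp add: inner_sum_right)
  finally show ?thesis .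
qed

definition mat_square ::
    "'i set \<Rightarrow> ('i \<Rightarrow> 'i \<Rightarrow> 'h::real_inner \<Rightarrow>\<^sub>L 'h) \<Rightarrow> 'i \<Rightarrow> 'i \<Rightarrow> 'h \<Rightarrow>\<^sub>L 'h" where
  "mat_square I M i j = (\<Sum>k\<in>I. M i k o\<^sub>L M k j)"

lemma mat_vec_square: "mat_vec I (mat_square I M) h = mat_vec I M (mat_vec I M h)"
  unfolding mat_vec_def mat_square_def blinfun_apply_sum blinfun.sum_right
    blinfun_apply_blinfun_compose
  by (intro ext sum.swap)

section \<open>The Riesz-Nagy iteration\<close>

primrec riesz_nagy_seq ::
    "'i set \<Rightarrow> ('i \<Rightarrow> 'i \<Rightarrow> 'h::real_inner \<Rightarrow>\<^sub>L 'h) \<Rightarrow> nat \<Rightarrow> 'i \<Rightarrow> 'i \<Rightarrow> 'h \<Rightarrow>\<^sub>L 'h" where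
  "riesz_nagy_seq I M 0 = M"
| "riesz_nagy_seq I M (Suc m) =
     (\<lambda>i j. riesz_nagy_seq I M m i j - mat_square I (riesz_nagy_seq I M m) i j)"

lemma mat_vec_riesz_nagy_Suc:
  "mat_vec I (riesz_nagy_seq I M (Suc m)) h =
   (\<lambda>i. mat_vec I (riesz_nagy_seq I M m) h i -
        mat_vec I (riesz_nagy_seq I M m) (mat_vec I (riesz_nagy_seq I M m) h) i)"
proof -
  have "mat_vec I (riesz_nagy_seq I M (Suc m)) h =
    (\<lambda>i. mat_vec I (riesz_nagy_seq I M m) h i -
         mat_vec I (mat_square I (riesz_nagy_seq I M m)) h i)"
    unfolding mat_vec_def riesz_nagy_seq.simps blinfun.diff_left sum_subtractf ..
  then show ?thesis by (simp add: mat_vec_square)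
qed

lemma mat_symmetric_square:
  assumes "mat_symmetric I M"
  shows "mat_symmetric I (mat_square I M)"
  using assms
  by (simp add: mat_symmetric_def mat_square_def blinfun_apply_sum inner_sum_left inner_sum_right)

text \<open>The bounds are inherited because \<open>B - B\<^sup>2 = B(1 - B)B + (1 - B)B(1 - B)\<close>.\<close>

lemma riesz_nagy_invariant:
  assumes "mat_symmetric I M" "mat_nonneg I M" "mat_contractive I M"
  shows "mat_symmetric I (riesz_nagy_seq I M m) \<and> mat_nonneg I (riesz_nagy_seq I M m)
    \<and> mat_contractive I (riesz_nagy_seq I M m)"
proof (induction m)
  case (Suc m)
  define B where "B = riesz_nagy_seq I M m"
  have sym: "mat_symmetric I B" and pos: "mat_nonneg I B" and con: "mat_contractive I B"
    using Suc by (auto simp: B_def)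
  have step: "vec_inner I (mat_vec I (riesz_nagy_seq I M (Suc m)) h) h =
      vec_inner I (mat_vec I B h) h - vec_inner I (mat_vec I B h) (mat_vec I B h)" for h
    unfolding mat_vec_riesz_nagy_Suc B_def[symmetric] vec_inner_diff_left
    by (simp add: mat_symmetric_vec_inner[OF sym])
  have "vec_inner I (mat_vec I B h) (mat_vec I B h) \<le> vec_inner I (mat_vec I B h) h" for h
  proof -
    define y where "y = mat_vec I B h"
    \<comment> \<open>This is the form of (1 - B) B (1 - B) at \<open>h\<close>. Expanding it by
      symmetry and bounding the form of B^3 by that of B^2 leaves B^2 \<le> B.\<close>
    have "0 \<le> vec_inner I (mat_vec I B (\<lambda>i. h i - y i)) (\<lambda>i. h i - y i)"
      using pos unfolding mat_nonneg_def by blast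
    also have "\<dots> = vec_inner I y h - vec_inner I y y - vec_inner I (mat_vec I B y) h
        + vec_inner I (mat_vec I B y) y"
      unfolding mat_vec_diff y_def[symmetric] vec_inner_diff_left vec_inner_diff_right by simp
    also have "vec_inner I (mat_vec I B y) h = vec_inner I y y"
      unfolding mat_symmetric_vec_inner[OF sym] y_def ..
    also have "vec_inner I (mat_vec I B y) y \<le> vec_inner I y y"
      using con unfolding mat_contractive_def by blast
    finally show ?thesis unfolding y_def by simp
  qed
  then have "mat_nonneg I (riesz_nagy_seq I M (Suc m))"
    unfolding mat_nonneg_def step by simp
  moreover have "mat_contractive I (riesz_nagy_seq I M (Suc m))"
    unfolding mat_contractive_def step
  proof
    fix h show "vec_inner I (mat_vec I B h) h - vec_inner I (mat_vec I B h) (mat_vec I B h)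
        \<le> vec_inner I h h"
      using con vec_inner_self_nonneg[of I "mat_vec I B h"] unfolding mat_contractive_def
      by (smt (verit))
  qed
  moreover have "mat_symmetric I (riesz_nagy_seq I M (Suc m))"
    using sym mat_symmetric_square[OF sym] unfolding mat_symmetric_def
    by (simp add: blinfun.diff_left inner_diff_left inner_diff_right B_def)
  ultimately show ?case by blast
qed (use assms in auto)

text \<open>Pairing the recursion with \<open>h\<close> telescopes: the squared norms of the vectors
  B_k h for k < m add up to the form of B_0 minus that of B_m, hence to at most the form of B_0.
  They are therefore summable and tend to 0.\<close>

lemma riesz_nagy_tendsto_0:
  assumes I: "finite I" and M: "mat_symmetric I M" "mat_nonneg I M" "mat_contractive I M"
    and i: "i \<in> I"
  shows "(\<lambda>m. mat_vec I (riesz_nagy_seq I M m) h i) \<longlonglongrightarrow> 0"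
proof -
  define y where "y m = mat_vec I (riesz_nagy_seq I M m) h" for m
  note inv = riesz_nagy_invariant[OF M]
  have step: "vec_inner I (y (Suc m)) h = vec_inner I (y m) h - vec_inner I (y m) (y m)" for m
    using inv[of m] unfolding y_def mat_vec_riesz_nagy_Suc vec_inner_diff_left
    by (simp add: mat_symmetric_vec_inner)
  have tele: "(\<Sum>k<m. vec_inner I (y k) (y k)) = vec_inner I (y 0) h - vec_inner I (y m) h" for m
    by (induction m) (simp_all add: step)
  have "summable (\<lambda>k. vec_inner I (y k) (y k))"
  proof (rule summableI_nonneg_bounded)
    show "(\<Sum>k<m. vec_inner I (y k) (y k)) \<le> vec_inner I (y 0) h" for m
      using inv[of m] unfolding tele unfolding y_def mat_nonneg_def by (simp only: diff_le_eq) simp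
  qed (rule vec_inner_self_nonneg)
  then have lim: "(\<lambda>k. vec_inner I (y k) (y k)) \<longlonglongrightarrow> 0" by (rule summable_LIMSEQ_zero)
  have "(\<lambda>k. (norm (y k i))\<^sup>2) \<longlonglongrightarrow> 0"
  proof (rule tendsto_sandwich[OF _ _ tendsto_const lim])
    show "\<forall>\<^sub>F k in sequentially. (norm (y k i))\<^sup>2 \<le> vec_inner I (y k) (y k)"
      unfolding vec_inner_def power2_norm_eq_inner
      by (intro always_eventually allI member_le_sum[OF i _ I]) simp
  qed simp
  then have "(\<lambda>k. sqrt ((norm (y k i))\<^sup>2)) \<longlonglongrightarrow> sqrt 0" by (rule tendsto_real_sqrt)
  then show ?thesis unfolding y_def by (simp add: tendsto_norm_zero_iff)
qed

section \<open>Positivity of entrywise products\<close>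

definition mat_schur ::
    "('i \<Rightarrow> 'i \<Rightarrow> 'h::real_inner \<Rightarrow>\<^sub>L 'h) \<Rightarrow> ('i \<Rightarrow> 'i \<Rightarrow> 'h \<Rightarrow>\<^sub>L 'h) \<Rightarrow> 'i \<Rightarrow> 'i \<Rightarrow> 'h \<Rightarrow>\<^sub>L 'h" where
  "mat_schur A B i j = A i j o\<^sub>L B i j"

lemma mat_form_eq:
  "vec_inner I (mat_vec I M h) h = (\<Sum>i\<in>I. \<Sum>j\<in>I. inner (M i j (h j)) (h i))"
  unfolding vec_inner_def mat_vec_def by (simp add: inner_sum_left)

lemma mat_schur_square_nonneg:
  fixes A B :: "'i \<Rightarrow> 'i \<Rightarrow> 'h::real_inner \<Rightarrow>\<^sub>L 'h"
  assumes "mat_nonneg I A" "mat_symmetric I B"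
    and comm: "\<And>i j k l x. \<lbrakk>i \<in> I; j \<in> I; k \<in> I; l \<in> I\<rbrakk> \<Longrightarrow> A i j (B k l x) = B k l (A i j x)"
  shows "mat_nonneg I (mat_schur A (mat_square I B))"
  unfolding mat_nonneg_def
proof
  fix h
  \<comment> \<open>Commutation brings \<open>B i k\<close> in front of \<open>A i j\<close>;
    symmetry then moves it to the other argument as \<open>B k i\<close>.\<close>
  have eq: "inner (A i j (B i k (B k j (h j)))) (h i) = inner (A i j (B k j (h j))) (B k i (h i))"
    if "i \<in> I" "j \<in> I" "k \<in> I" for i j k
    using that assms(2) comm unfolding mat_symmetric_def by simp
  have "vec_inner I (mat_vec I (mat_schur A (mat_square I B)) h) h
      = (\<Sum>i\<in>I. \<Sum>j\<in>I. \<Sum>k\<in>I. inner (A i j (B i k (B k j (h j)))) (h i))"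
    unfolding mat_form_eq mat_schur_def mat_square_def
    by (simp add: blinfun_apply_sum blinfun.sum_right inner_sum_left)
  also have "\<dots> = (\<Sum>i\<in>I. \<Sum>j\<in>I. \<Sum>k\<in>I. inner (A i j (B k j (h j))) (B k i (h i)))"
    by (intro sum.cong refl eq)
  \<comment> \<open>Once \<open>k\<close> is the outermost index, each inner double sum is the form
    of \<open>A\<close> at the vector j \<mapsto> B k j (h j).\<close>
  also have "\<dots> = (\<Sum>i\<in>I. \<Sum>k\<in>I. \<Sum>j\<in>I. inner (A i j (B k j (h j))) (B k i (h i)))"
    by (intro sum.cong refl sum.swap)
  also have "\<dots> = (\<Sum>k\<in>I. \<Sum>i\<in>I. \<Sum>j\<in>I. inner (A i j (B k j (h j))) (B k i (h i)))"
    by (rule sum.swap)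
  also have "\<dots> = (\<Sum>k\<in>I. vec_inner I (mat_vec I A (\<lambda>j. B k j (h j))) (\<lambda>j. B k j (h j)))"
    unfolding mat_form_eq ..
  also have "\<dots> \<ge> 0" using assms(1) unfolding mat_nonneg_def by (intro sum_nonneg) blast
  finally show "0 \<le> vec_inner I (mat_vec I (mat_schur A (mat_square I B)) h) h" .
qed

text \<open>Every entry of an iterate is a noncommutative polynomial in the entries of
  \<open>B\<close>.\<close>

lemma riesz_nagy_commute:
  fixes A B :: "'i \<Rightarrow> 'i \<Rightarrow> 'h::real_inner \<Rightarrow>\<^sub>L 'h"
  assumes "\<And>i j k l x. \<lbrakk>i \<in> I; j \<in> I; k \<in> I; l \<in> I\<rbrakk> \<Longrightarrow> A i j (B k l x) = B k l (A i j x)"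
    and "i \<in> I" "j \<in> I" "k \<in> I" "l \<in> I"
  shows "A i j (riesz_nagy_seq I B m k l x) = riesz_nagy_seq I B m k l (A i j x)"
  using assms(2-)
proof (induction m arbitrary: k l x)
  case (Suc m)
  then show ?case
    by (auto simp: blinfun.diff_left blinfun.diff_right mat_square_def blinfun_apply_sum
        blinfun.sum_right intro!: sum.cong)
qed (use assms(1) in simp)

text \<open>Each iteration step subtracts the entrywise product of \<open>A\<close> with a square,
  whose form is nonnegative, so the forms decrease in \<open>m\<close>. They tend to 0 along with
  the entries of the iterates, hence the initial form is nonnegative.\<close>

lemma mat_schur_contractive_nonneg:
  fixes A B :: "'i \<Rightarrow> 'i \<Rightarrow> 'h::real_inner \<Rightarrow>\<^sub>L 'h"
  assumes I: "finite I" and A: "mat_nonneg I A"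
    and B: "mat_symmetric I B" "mat_nonneg I B" "mat_contractive I B"
    and comm: "\<And>i j k l x. \<lbrakk>i \<in> I; j \<in> I; k \<in> I; l \<in> I\<rbrakk> \<Longrightarrow> A i j (B k l x) = B k l (A i j x)"
  shows "mat_nonneg I (mat_schur A B)"
  unfolding mat_nonneg_def
proof
  fix h
  define S where "S m = vec_inner I (mat_vec I (mat_schur A (riesz_nagy_seq I B m)) h) h" for m
  have S_Suc: "S (Suc m) \<le> S m" for m
  proof -
    have "S (Suc m) = S m -
        vec_inner I (mat_vec I (mat_schur A (mat_square I (riesz_nagy_seq I B m))) h) h"
      unfolding S_def mat_form_eq mat_schur_def
      by (simp add: blinfun.diff_left blinfun.diff_right inner_diff_left sum_subtractf)
    moreover have "mat_nonneg I (mat_schur A (mat_square I (riesz_nagy_seq I B m)))"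
      using riesz_nagy_invariant[OF B] riesz_nagy_commute[of I A B] comm
      by (intro mat_schur_square_nonneg A) blast+
    ultimately show ?thesis unfolding mat_nonneg_def by (metis diff_ge_0_iff_ge diff_diff_eq2 add_diff_cancel_left')
  qed
  have S_le: "S m \<le> S 0" for m
    by (induction m) (use S_Suc order_trans in blast)+
  \<comment> \<open>A single entry is read off by applying the matrix to a vector supported at
    \<open>j\<close>.\<close>
  have entry: "(\<lambda>m. riesz_nagy_seq I B m i j (h j)) \<longlonglongrightarrow> 0" if "i \<in> I" "j \<in> I" for i j
  proof -
    have "mat_vec I (riesz_nagy_seq I B m) (\<lambda>k. if k = j then h j else 0) i
        = riesz_nagy_seq I B m i j (h j)" for m
      unfolding mat_vec_def using I that
      by (subst sum.remove[of _ j]) (auto intro!: sum.neutral)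
    then show ?thesis
      using riesz_nagy_tendsto_0[OF I B that(1), of "\<lambda>k. if k = j then h j else 0"] by simp
  qed
  have S_eq: "S m = (\<Sum>i\<in>I. \<Sum>j\<in>I. inner (A i j (riesz_nagy_seq I B m i j (h j))) (h i))" for m
    unfolding S_def mat_form_eq by (simp add: mat_schur_def)
  have "S \<longlonglongrightarrow> (\<Sum>i\<in>I. \<Sum>j\<in>I. inner (A i j 0) (h i))"
    unfolding S_eq
    by (intro tendsto_sum tendsto_inner tendsto_const blinfun.tendsto entry)
  then have "S \<longlonglongrightarrow> 0" by simp
  then have "0 \<le> S 0" by (rule LIMSEQ_le_const2) (use S_le in blast)
  then show "0 \<le> vec_inner I (mat_vec I (mat_schur A B) h) h" by (simp add: S_def)
qed

lemma mat_form_bound: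
  fixes B :: "'i \<Rightarrow> 'i \<Rightarrow> 'h::real_inner \<Rightarrow>\<^sub>L 'h"
  assumes "finite I"
  obtains c where "0 < c"
    and "\<And>h. vec_inner I (mat_vec I B h) h \<le> c * vec_inner I h h"
proof
  \<comment> \<open>The added 1 keeps the constant positive when all entries vanish, so that it can
    serve as a divisor.\<close>
  let ?c = "(\<Sum>i\<in>I. \<Sum>j\<in>I. norm (B i j)) + 1"
  show "0 < ?c" by (simp add: sum_nonneg add_nonneg_pos)
  fix h :: "'i \<Rightarrow> 'h"
  have le: "(norm (h i))\<^sup>2 \<le> vec_inner I h h" if "i \<in> I" for i
    unfolding vec_inner_def power2_norm_eq_inner
    by (rule member_le_sum[OF that _ assms]) simp
  have "inner (B i j (h j)) (h i) \<le> norm (B i j) * vec_inner I h h" if "i \<in> I" "j \<in> I" for i j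
  proof -
    have "inner (B i j (h j)) (h i) \<le> norm (B i j (h j)) * norm (h i)"
      by (rule norm_cauchy_schwarz)
    also have "\<dots> \<le> (norm (B i j) * norm (h j)) * norm (h i)"
      by (intro mult_right_mono norm_blinfun) auto
    also have "\<dots> = norm (B i j) * (norm (h j) * norm (h i))" by simp
    \<comment> \<open>Both squares are at most \<open>vec_inner I h h\<close>, and a product is at
      most half the sum of the squares.\<close>
    also have "norm (h j) * norm (h i) \<le> vec_inner I h h"
      using le[OF that(1)] le[OF that(2)] sum_squares_bound[of "norm (h j)" "norm (h i)"] by simp
    finally show ?thesis by (simp add: mult_left_mono)
  qed
  then have "vec_inner I (mat_vec I B h) h \<le> (\<Sum>i\<in>I. \<Sum>j\<in>I. norm (B i j) * vec_inner I h h)"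
    unfolding mat_form_eq by (intro sum_mono)
  also have "\<dots> \<le> ?c * vec_inner I h h"
    using vec_inner_self_nonneg[of I h] by (simp add: sum_distrib_right distrib_right)
  finally show "vec_inner I (mat_vec I B h) h \<le> ?c * vec_inner I h h" .
qed

text \<open>Dividing \<open>B\<close> by the constant of \<open>mat_form_bound\<close> reduces to
  the contractive case; the entrywise product scales by the same factor.\<close>

lemma mat_schur_nonneg:
  fixes A B :: "'i \<Rightarrow> 'i \<Rightarrow> 'h::real_inner \<Rightarrow>\<^sub>L 'h"
  assumes I: "finite I" and A: "mat_nonneg I A"
    and B: "mat_symmetric I B" "mat_nonneg I B"
    and comm: "\<And>i j k l x. \<lbrakk>i \<in> I; j \<in> I; k \<in> I; l \<in> I\<rbrakk> \<Longrightarrow> A i j (B k l x) = B k l (A i j x)"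
  shows "mat_nonneg I (mat_schur A B)"
proof -
  obtain c where c: "0 < c" "\<And>h. vec_inner I (mat_vec I B h) h \<le> c * vec_inner I h h"
    using mat_form_bound[OF I, of B] by blast
  define C where "C i j = (1 / c) *\<^sub>R B i j" for i j
  have form_C: "vec_inner I (mat_vec I C h) h = vec_inner I (mat_vec I B h) h / c" for h
    unfolding mat_form_eq C_def by (simp add: blinfun.scaleR_left sum_divide_distrib)
  have "mat_nonneg I (mat_schur A C)"
  proof (rule mat_schur_contractive_nonneg[OF I A])
    show "mat_symmetric I C"
      using B(1) unfolding mat_symmetric_def C_def by (simp add: blinfun.scaleR_left)
    show "mat_nonneg I C"
      using B(2) c(1) unfolding mat_nonneg_def form_C by simp
    show "mat_contractive I C"
      using c unfolding mat_contractive_def form_C by (simp add: divide_le_eq mult.commute)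
    show "A i j (C k l x) = C k l (A i j x)" if "i \<in> I" "j \<in> I" "k \<in> I" "l \<in> I" for i j k l x
      using comm[OF that] by (simp add: C_def blinfun.scaleR_left blinfun.scaleR_right)
  qed
  moreover have "vec_inner I (mat_vec I (mat_schur A C) h) h
      = vec_inner I (mat_vec I (mat_schur A B) h) h / c" for h
    unfolding mat_form_eq mat_schur_def C_def
    by (simp add: blinfun.scaleR_left blinfun.scaleR_right sum_divide_distrib)
  ultimately show ?thesis
    using c(1) unfolding mat_nonneg_def by (simp add: zero_le_divide_iff)
qed

section \<open>Complex and real positivity of operator matrices\<close>

lemma cinner_zero_left: "cinner 0 y = 0"
  using cinner_add_left[of 0 0 y] by simp

lemma cinner_sum_left: "cinner (\<Sum>i\<in>I. f i) y = (\<Sum>i\<in>I. cinner (f i) y)"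
  by (induction I rule: infinite_finite_induct) (simp_all add: cinner_zero_left cinner_add_left)

text \<open>The Hermitian condition makes the complex sum equal to its own conjugate, so only the
  sign of its real part remains, and that part is the real quadratic form.\<close>

lemma positive_op_matrix_iff:
  assumes herm: "\<And>i j x y. i < n \<Longrightarrow> j < n \<Longrightarrow> cinner (blinfun_apply (A i j) x) y = cinner x (blinfun_apply (A j i) y)"
  shows "positive_op_matrix n A \<longleftrightarrow> mat_nonneg {..<n} A"
proof -
  define S where "S h = (\<Sum>i<n. cinner (\<Sum>j<n. blinfun_apply (A i j) (h j)) (h i))" for h
  have Re: "Re (S h) = vec_inner {..<n} (mat_vec {..<n} A h) h" for h
    unfolding S_def vec_inner_def mat_vec_def by (simp add: Re_cinner)
  have "cnj (S h) = S h" for h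
  proof -
    have "cnj (S h) = (\<Sum>i<n. \<Sum>j<n. cnj (cinner (A i j (h j)) (h i)))"
      unfolding S_def by (simp add: cinner_sum_left)
    also have "\<dots> = (\<Sum>i<n. \<Sum>j<n. cinner (A j i (h i)) (h j))"
      by (intro sum.cong refl) (simp add: herm flip: cinner_commute)
    also have "\<dots> = (\<Sum>j<n. \<Sum>i<n. cinner (A j i (h i)) (h j))"
      by (rule sum.swap)
    also have "\<dots> = S h"
      unfolding S_def by (simp add: cinner_sum_left)
    finally show ?thesis .
  qed
  then have Im: "Im (S h) = 0" for h
    by (metis complex_cnj_cancel_iff complex_cnj cnj.sel(2) equal_neg_zero)
  show ?thesis
    unfolding positive_op_matrix_def mat_nonneg_def S_def[symmetric] complex_nonneg_Reals_iff
    by (simp add: Re Im)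
qed

lemma mat_nonneg_cong:
  assumes "\<And>i j. i \<in> I \<Longrightarrow> j \<in> I \<Longrightarrow> M i j = N i j"
  shows "mat_nonneg I M \<longleftrightarrow> mat_nonneg I N"
  unfolding mat_nonneg_def mat_form_eq using assms by simp

section \<open>Kernels of contractive representations\<close>

text \<open>The interface shared by the summands and the direct sum: cancellation makes left
  quotients unique, and \<open>lcm_set\<close> is treated by cases according to whether it is
  empty.\<close>

locale left_cancellative_monoid = monoid P for P (structure) +
  assumes left_cancel:
    "\<lbrakk>p \<in> carrier P; a \<in> carrier P; b \<in> carrier P; p \<otimes> a = p \<otimes> b\<rbrakk> \<Longrightarrow> a = b"
begin

lemma mem_ideal_iff: "s \<in> p <# carrier P \<longleftrightarrow> (\<exists>t\<in>carrier P. s = p \<otimes> t)"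
  by (auto simp: l_coset_def)

lemma left_quotient_mult:
  assumes "p \<in> carrier P" "t \<in> carrier P"
  shows "left_quotient P p (p \<otimes> t) = t"
  unfolding left_quotient_def by (rule the_equality) (use assms left_cancel in blast)+

lemma left_quotient_closed:
  assumes "p \<in> carrier P" "s \<in> p <# carrier P"
  shows "left_quotient P p s \<in> carrier P"
  using assms left_quotient_mult by (auto simp: mem_ideal_iff)

lemma mult_left_quotient:
  assumes "p \<in> carrier P" "s \<in> p <# carrier P"
  shows "p \<otimes> left_quotient P p s = s"
  using assms left_quotient_mult by (auto simp: mem_ideal_iff)

lemma left_quotient_self: "p \<in> carrier P \<Longrightarrow> left_quotient P p p = \<one>"
  using left_quotient_mult[of p \<one>] by simp

lemma mem_ideal_self: "p \<in> carrier P \<Longrightarrow> p \<in> p <# carrier P"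
  unfolding mem_ideal_iff by (intro bexI[of _ \<one>]) simp_all

lemma lcm_setD:
  assumes "s \<in> lcm_set P p q"
  shows "s \<in> carrier P" "s \<in> p <# carrier P" "s \<in> q <# carrier P"
  using assms mem_ideal_self unfolding lcm_set_def by blast+

lemma lcm_set_one: "\<one> \<in> lcm_set P \<one> \<one>"
  unfolding lcm_set_def by simp

end

lemma lcm_set_commute: "lcm_set P p q = lcm_set P q p"
  unfolding lcm_set_def by (simp add: Int_commute)

sublocale right_lcm_semigroup \<subseteq> left_cancellative_monoid
  by unfold_locales (rule left_cancel)

locale contractive_rep = left_cancellative_monoid P for P :: "('a, 'm) monoid_scheme" (structure) +
  fixes T :: "'a \<Rightarrow> 'h::complex_hilbert_space \<Rightarrow>\<^sub>L 'h"
  assumes rep: "unital_contractive_rep P T"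
begin

lemma rep_clinear: "p \<in> carrier P \<Longrightarrow> clinear_op (T p)"
  and rep_norm: "p \<in> carrier P \<Longrightarrow> norm (T p) \<le> 1"
  and rep_one: "T \<one> = id_blinfun"
  and rep_mult: "p \<in> carrier P \<Longrightarrow> q \<in> carrier P \<Longrightarrow> T (p \<otimes> q) = T p o\<^sub>L T q"
  using rep unfolding unital_contractive_rep_def by auto

lemma rep_norm_le: "p \<in> carrier P \<Longrightarrow> norm (T p x) \<le> norm x"
  using norm_blinfun[of "T p" x] rep_norm[of p] mult_right_mono[of "norm (T p)" 1 "norm x"] by simp

text \<open>\<open>T u\<close> and its inverse \<open>T w\<close> are both contractions, so
  \<open>T u\<close> is isometric. By polarisation it preserves inner products, and its adjoint is
  therefore \<open>T w\<close>.\<close>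

lemma rep_unit_coisometry:
  assumes u: "u \<in> carrier P" and w: "w \<in> carrier P" and uw: "u \<otimes> w = \<one>" and wu: "w \<otimes> u = \<one>"
  shows "T u o\<^sub>L adjoint_op (T u) = id_blinfun"
proof -
  have Tuw: "T u (T w x) = x" for x
    using rep_mult[OF u w] uw rep_one by (metis blinfun_apply_blinfun_compose blinfun_apply_id_blinfun id_apply)
  have Twu: "T w (T u x) = x" for x
    using rep_mult[OF w u] wu rep_one by (metis blinfun_apply_blinfun_compose blinfun_apply_id_blinfun id_apply)
  have norm: "norm (T u x) = norm x" for x
    using rep_norm_le[OF u, of x] rep_norm_le[OF w, of "T u x"] Twu[of x] by simp
  have "inner (T u x) (T u y) = inner x y" for x y
    using norm[of "x + y"] norm[of x] norm[of y]
    by (simp add: dot_norm blinfun.add_right)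
  then have "inner (adjoint_op (T u) y) x = inner (T w y) x" for x y
    using Tuw[of y] inner_adjoint_op_left[OF rep_clinear[OF u]]
    by (metis inner_commute)
  then have "adjoint_op (T u) y = T w y" for y
    by (rule inner_ext)
  then show ?thesis
    by (intro blinfun_eqI) (simp add: Tuw)
qed

text \<open>Replaces the \<open>SOME\<close> in \<open>regular_kernel\<close> by any convenient
  least common multiple. Two choices differ by a unit \<open>u\<close>, and \<open>T u\<close>
  cancels against its adjoint between the two factors.\<close>

lemma regular_kernel_eq:
  assumes p: "p \<in> carrier P" and q: "q \<in> carrier P" and s: "s \<in> lcm_set P p q"
  shows "regular_kernel P T p q = T (left_quotient P p s) o\<^sub>L adjoint_op (T (left_quotient P q s))"
proof -
  define r where "r = (SOME r. r \<in> lcm_set P p q)"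
  have r: "r \<in> lcm_set P p q" unfolding r_def using s by (rule someI)
  have rs: "r <# carrier P = s <# carrier P" using r s unfolding lcm_set_def by blast
  note rD = lcm_setD[OF r] and sD = lcm_setD[OF s]
  have "r \<in> s <# carrier P" "s \<in> r <# carrier P" using rs mem_ideal_self rD(1) sD(1) by blast+
  then obtain u w where u: "u \<in> carrier P" "r = s \<otimes> u" and w: "w \<in> carrier P" "s = r \<otimes> w"
    by (auto simp: mem_ideal_iff)
  \<comment> \<open>Cancelling \<open>s\<close> here and \<open>r\<close> below shows that
    \<open>u\<close> and \<open>w\<close> are mutually inverse.\<close>
  have "s \<otimes> (u \<otimes> w) = s \<otimes> \<one>" using u w sD(1) by (metis m_assoc r_one)
  then have uw: "u \<otimes> w = \<one>" using left_cancel u w sD(1) by (metis m_closed one_closed)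
  have "r \<otimes> (w \<otimes> u) = r \<otimes> \<one>" using u w rD(1) by (metis m_assoc r_one)
  then have wu: "w \<otimes> u = \<one>" using left_cancel u w rD(1) by (metis m_closed one_closed)
  have quot: "T (left_quotient P p' r) = T (left_quotient P p' s) o\<^sub>L T u"
    "left_quotient P p' s \<in> carrier P"
    if p': "p' \<in> carrier P" "s \<in> p' <# carrier P" for p'
  proof -
    note c = left_quotient_closed[OF p']
    have "r = p' \<otimes> (left_quotient P p' s \<otimes> u)"
      using mult_left_quotient[OF p'] u(2) m_assoc[OF p'(1) c u(1)] by simp
    then have "left_quotient P p' r = left_quotient P p' s \<otimes> u"
      using left_quotient_mult[OF p'(1), of "left_quotient P p' s \<otimes> u"] c u(1) by simp
    then show "T (left_quotient P p' r) = T (left_quotient P p' s) o\<^sub>L T u"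
      using rep_mult[OF c u(1)] by simp
  qed (rule left_quotient_closed[OF p'])
  have unit: "T u (adjoint_op (T u) x) = x" for x
    using rep_unit_coisometry[OF u(1) w(1) uw wu]
    by (metis blinfun_apply_blinfun_compose blinfun_apply_id_blinfun id_apply)
  have "regular_kernel P T p q = T (left_quotient P p r) o\<^sub>L adjoint_op (T (left_quotient P q r))"
    unfolding regular_kernel_def using s by (auto simp: r_def Let_def)
  also have "\<dots> = T (left_quotient P p s) o\<^sub>L adjoint_op (T (left_quotient P q s))"
    by (intro blinfun_eqI)
      (simp add: quot p q sD adjoint_op_compose rep_clinear u(1) unit)
  finally show ?thesis .
qed

lemma regular_kernel_cases:
  assumes "p \<in> carrier P" "q \<in> carrier P"
  obtains "lcm_set P p q = {}" "regular_kernel P T p q = 0"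
  | s where "s \<in> lcm_set P p q" "left_quotient P p s \<in> carrier P" "left_quotient P q s \<in> carrier P"
      "regular_kernel P T p q = T (left_quotient P p s) o\<^sub>L adjoint_op (T (left_quotient P q s))"
proof (cases "lcm_set P p q = {}")
  case True
  then show ?thesis using that(1) by (simp add: regular_kernel_def)
next
  case False
  then obtain s where s: "s \<in> lcm_set P p q" by blast
  show ?thesis
    using that(2)[OF s] assms s lcm_setD left_quotient_closed regular_kernel_eq by blast
qed

text \<open>\<open>lcm_set\<close> is symmetric in its two elements, so one \<open>s\<close>
  computes both kernels, and interchanging the factors amounts to taking the adjoint.\<close>

lemma regular_kernel_hermitian:
  assumes p: "p \<in> carrier P" and q: "q \<in> carrier P"
  shows "cinner (regular_kernel P T p q x) y = cinner x (regular_kernel P T q p y)"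
  using p q
proof (cases rule: regular_kernel_cases)
  case 1
  then show ?thesis
    by (simp add: regular_kernel_def lcm_set_commute[of P q p] cinner_zero_left)
      (simp add: cinner_commute[of x 0] cinner_zero_left)
next
  case (2 s)
  then have "regular_kernel P T q p = T (left_quotient P q s) o\<^sub>L adjoint_op (T (left_quotient P p s))"
    using p q by (intro regular_kernel_eq) (simp_all add: lcm_set_commute)
  then show ?thesis
    using 2 by (simp add: cinner_adjoint_op cinner_adjoint_op_left rep_clinear)
qed

lemma regular_kernel_mat_symmetric:
  assumes "\<And>i. i \<in> I \<Longrightarrow> p i \<in> carrier P"
  shows "mat_symmetric I (\<lambda>i j. regular_kernel P T (p i) (p j))"
  unfolding mat_symmetric_def using assms regular_kernel_hermitian by (metis Re_cinner)

lemma star_regular_dilation_iff: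
  "has_star_regular_dilation P T \<longleftrightarrow>
     (\<forall>n p. (\<forall>i<n::nat. p i \<in> carrier P) \<longrightarrow>
        mat_nonneg {..<n} (\<lambda>i j. regular_kernel P T (p i) (p j)))"
  unfolding has_star_regular_dilation_def completely_positive_definite_def
  using rep regular_kernel_hermitian by (simp add: positive_op_matrix_iff)

lemma star_regular_dilation_mat_nonneg:
  fixes n :: nat
  assumes "has_star_regular_dilation P T" and "\<And>i. i < n \<Longrightarrow> p i \<in> carrier P"
  shows "mat_nonneg {..<n} (\<lambda>i j. regular_kernel P T (p i) (p j))"
  using assms(2) star_regular_dilation_iff[THEN iffD1, OF assms(1), rule_format] by simp

end

section \<open>Direct sums of right LCM semigroups\<close>

locale right_lcm_family =
  fixes V :: "'v set" and P :: "'v \<Rightarrow> ('a, 'm) monoid_scheme"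
  assumes right_lcm_summand: "v \<in> V \<Longrightarrow> right_lcm_semigroup (P v)"
begin

abbreviation D where "D \<equiv> direct_sum_monoid V P"

lemma summand_left_cancellative: "v \<in> V \<Longrightarrow> left_cancellative_monoid (P v)"
  using right_lcm_summand right_lcm_semigroup.axioms(1)
  by (metis left_cancellative_monoid_axioms.intro left_cancellative_monoid_def right_lcm_semigroup.left_cancel)

lemma summand_monoid: "v \<in> V \<Longrightarrow> monoid (P v)"
  using summand_left_cancellative left_cancellative_monoid.axioms(1) by blast

lemma mem_direct_sum_iff:
  "x \<in> carrier D \<longleftrightarrow> x \<in> (\<Pi>\<^sub>E v\<in>V. carrier (P v)) \<and> finite {v \<in> V. x v \<noteq> \<one>\<^bsub>P v\<^esub>}"
  by (simp add: direct_sum_monoid_def)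

lemma direct_sum_one: "\<one>\<^bsub>D\<^esub> = (\<lambda>v\<in>V. \<one>\<^bsub>P v\<^esub>)"
  and direct_sum_mult: "x \<otimes>\<^bsub>D\<^esub> y = (\<lambda>v\<in>V. x v \<otimes>\<^bsub>P v\<^esub> y v)"
  by (simp_all add: direct_sum_monoid_def)

lemma direct_sum_component: "x \<in> carrier D \<Longrightarrow> v \<in> V \<Longrightarrow> x v \<in> carrier (P v)"
  by (auto simp: mem_direct_sum_iff)

lemma direct_sum_ext:
  assumes "x \<in> carrier D" "y \<in> carrier D" "\<And>v. v \<in> V \<Longrightarrow> x v = y v"
  shows "x = y"
  using assms(1,2) unfolding mem_direct_sum_iff by (elim conjE) (rule PiE_ext, (assumption | rule assms(3))+)

lemma direct_sum_update:
  assumes "x \<in> carrier D" "v \<in> V" "p \<in> carrier (P v)"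
  shows "x(v := p) \<in> carrier D"
proof -
  have "{w \<in> V. (x(v := p)) w \<noteq> \<one>\<^bsub>P w\<^esub>} \<subseteq> insert v {w \<in> V. x w \<noteq> \<one>\<^bsub>P w\<^esub>}" by auto
  then have "finite {w \<in> V. (x(v := p)) w \<noteq> \<one>\<^bsub>P w\<^esub>}"
    by (rule finite_subset) (use assms in \<open>simp add: mem_direct_sum_iff\<close>)
  with assms show ?thesis
    by (auto simp: mem_direct_sum_iff PiE_iff extensional_def)
qed

lemma direct_sum_left_cancellative: "left_cancellative_monoid D"
proof -
  have closed: "x \<otimes>\<^bsub>D\<^esub> y \<in> carrier D" if x: "x \<in> carrier D" and y: "y \<in> carrier D" for x y
  proof -
    have "{v \<in> V. (x \<otimes>\<^bsub>D\<^esub> y) v \<noteq> \<one>\<^bsub>P v\<^esub>} \<subseteq> {v \<in> V. x v \<noteq> \<one>\<^bsub>P v\<^esub>} \<union> {v \<in> V. y v \<noteq> \<one>\<^bsub>P v\<^esub>}"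
      using summand_monoid by (auto simp: direct_sum_mult monoid.l_one)
    then have "finite {v \<in> V. (x \<otimes>\<^bsub>D\<^esub> y) v \<noteq> \<one>\<^bsub>P v\<^esub>}"
      by (rule finite_subset) (use x y in \<open>simp add: mem_direct_sum_iff\<close>)
    moreover have "x \<otimes>\<^bsub>D\<^esub> y \<in> (\<Pi>\<^sub>E v\<in>V. carrier (P v))"
      using direct_sum_component[OF x] direct_sum_component[OF y] summand_monoid
      by (auto simp: direct_sum_mult monoid.m_closed)
    ultimately show ?thesis by (simp add: mem_direct_sum_iff)
  qed
  have one: "\<one>\<^bsub>D\<^esub> \<in> carrier D"
    using summand_monoid by (auto simp: mem_direct_sum_iff direct_sum_one monoid.one_closed)
  interpret monoid D
  proof (rule monoidI)
    show "x \<otimes>\<^bsub>D\<^esub> y \<otimes>\<^bsub>D\<^esub> z = x \<otimes>\<^bsub>D\<^esub> (y \<otimes>\<^bsub>D\<^esub> z)"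
      if "x \<in> carrier D" "y \<in> carrier D" "z \<in> carrier D" for x y z
      using that direct_sum_component summand_monoid
      by (auto simp: direct_sum_mult monoid.m_assoc intro!: restrict_ext)
    show "\<one>\<^bsub>D\<^esub> \<otimes>\<^bsub>D\<^esub> x = x" if "x \<in> carrier D" for x
      by (rule direct_sum_ext[OF closed[OF one that] that])
        (use direct_sum_component[OF that] summand_monoid in
          \<open>simp add: direct_sum_mult direct_sum_one monoid.l_one\<close>)
    show "x \<otimes>\<^bsub>D\<^esub> \<one>\<^bsub>D\<^esub> = x" if "x \<in> carrier D" for x
      by (rule direct_sum_ext[OF closed[OF that one] that])
        (use direct_sum_component[OF that] summand_monoid in
          \<open>simp add: direct_sum_mult direct_sum_one monoid.r_one\<close>)
  qed (use closed one in auto)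
  show ?thesis
  proof
    fix p a b assume *: "p \<in> carrier D" "a \<in> carrier D" "b \<in> carrier D" "p \<otimes>\<^bsub>D\<^esub> a = p \<otimes>\<^bsub>D\<^esub> b"
    show "a = b"
    proof (rule direct_sum_ext)
      fix v assume v: "v \<in> V"
      have "p v \<otimes>\<^bsub>P v\<^esub> a v = p v \<otimes>\<^bsub>P v\<^esub> b v"
        using fun_cong[OF *(4), of v] v by (simp add: direct_sum_mult)
      then show "a v = b v"
        by (rule left_cancellative_monoid.left_cancel[OF summand_left_cancellative[OF v], rotated -1])
          (use * v direct_sum_component in auto)
    qed (use * in auto)
  qed
qed

section \<open>Ideals and least common multiples in the direct sum\<close>

sublocale dsum: left_cancellative_monoid D
  by (rule direct_sum_left_cancellative)

text \<open>Where \<open>x\<close> and \<open>z\<close> both have the identity as coordinate, so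
  does the quotient; hence the coordinatewise quotient has finite support.\<close>

lemma direct_sum_left_quotient_aux:
  assumes x: "x \<in> carrier D" and z: "z \<in> carrier D"
    and ideal: "\<And>v. v \<in> V \<Longrightarrow> z v \<in> x v <#\<^bsub>P v\<^esub> carrier (P v)"
  defines "t \<equiv> (\<lambda>v\<in>V. left_quotient (P v) (x v) (z v))"
  shows "t \<in> carrier D" "x \<otimes>\<^bsub>D\<^esub> t = z"
proof -
  have "{v \<in> V. t v \<noteq> \<one>\<^bsub>P v\<^esub>} \<subseteq> {v \<in> V. x v \<noteq> \<one>\<^bsub>P v\<^esub>} \<union> {v \<in> V. z v \<noteq> \<one>\<^bsub>P v\<^esub>}"
  proof -
    have "t v = \<one>\<^bsub>P v\<^esub>" if v: "v \<in> V" "x v = \<one>\<^bsub>P v\<^esub>" "z v = \<one>\<^bsub>P v\<^esub>" for v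
      using left_cancellative_monoid.left_quotient_self[OF summand_left_cancellative[OF v(1)]]
        monoid.one_closed[OF summand_monoid[OF v(1)]] v by (simp add: t_def)
    then show ?thesis by blast
  qed
  then have fin: "finite {v \<in> V. t v \<noteq> \<one>\<^bsub>P v\<^esub>}"
    by (rule finite_subset) (use x z in \<open>simp add: mem_direct_sum_iff\<close>)
  have "t v \<in> carrier (P v)" if "v \<in> V" for v
    using that left_cancellative_monoid.left_quotient_closed[OF summand_left_cancellative[OF that]]
      direct_sum_component[OF x that] ideal[OF that] by (simp add: t_def)
  then show t: "t \<in> carrier D" using fin by (auto simp: mem_direct_sum_iff t_def)
  show "x \<otimes>\<^bsub>D\<^esub> t = z"
  proof (rule direct_sum_ext)
    fix v assume v: "v \<in> V"
    show "(x \<otimes>\<^bsub>D\<^esub> t) v = z v"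
      using left_cancellative_monoid.mult_left_quotient[OF summand_left_cancellative[OF v]]
        direct_sum_component[OF x v] ideal[OF v] v by (simp add: t_def direct_sum_mult)
  qed (use x t z in auto)
qed

lemma direct_sum_mem_ideal_iff:
  assumes x: "x \<in> carrier D"
  shows "z \<in> x <#\<^bsub>D\<^esub> carrier D \<longleftrightarrow>
    z \<in> carrier D \<and> (\<forall>v\<in>V. z v \<in> x v <#\<^bsub>P v\<^esub> carrier (P v))"
proof
  assume "z \<in> x <#\<^bsub>D\<^esub> carrier D"
  then obtain t where t: "t \<in> carrier D" "z = x \<otimes>\<^bsub>D\<^esub> t" by (auto simp: dsum.mem_ideal_iff)
  moreover have "z v \<in> x v <#\<^bsub>P v\<^esub> carrier (P v)" if "v \<in> V" for v
    using left_cancellative_monoid.mem_ideal_iff[OF summand_left_cancellative[OF that]]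
      direct_sum_component[OF t(1) that] t(2) that by (auto simp: direct_sum_mult)
  ultimately show "z \<in> carrier D \<and> (\<forall>v\<in>V. z v \<in> x v <#\<^bsub>P v\<^esub> carrier (P v))"
    using x by auto
next
  assume z: "z \<in> carrier D \<and> (\<forall>v\<in>V. z v \<in> x v <#\<^bsub>P v\<^esub> carrier (P v))"
  then have "(\<lambda>v\<in>V. left_quotient (P v) (x v) (z v)) \<in> carrier D"
    "x \<otimes>\<^bsub>D\<^esub> (\<lambda>v\<in>V. left_quotient (P v) (x v) (z v)) = z"
    by (intro direct_sum_left_quotient_aux[OF x]; blast)+
  then show "z \<in> x <#\<^bsub>D\<^esub> carrier D"
    unfolding dsum.mem_ideal_iff by (intro bexI) (rule sym)
qed

lemma direct_sum_left_quotient: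
  assumes x: "x \<in> carrier D" and z: "z \<in> x <#\<^bsub>D\<^esub> carrier D" and v: "v \<in> V"
  shows "left_quotient D x z v = left_quotient (P v) (x v) (z v)"
proof -
  define t where "t = (\<lambda>v\<in>V. left_quotient (P v) (x v) (z v))"
  have "t \<in> carrier D" "x \<otimes>\<^bsub>D\<^esub> t = z"
    using z unfolding direct_sum_mem_ideal_iff[OF x] t_def
    by (intro direct_sum_left_quotient_aux[OF x]; blast)+
  then have "left_quotient D x z = t"
    using dsum.left_quotient_mult[OF x] by blast
  then show ?thesis using v by (simp add: t_def)
qed

text \<open>From right to left, membership in ideals is coordinatewise. From left to right, a common
  multiple \<open>t\<close> in one coordinate is made global by inserting it into \<open>r\<close>,
  whose other coordinates are common multiples already.\<close>

lemma direct_sum_mem_lcm_set_iff: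
  assumes x: "x \<in> carrier D" and y: "y \<in> carrier D"
  shows "r \<in> lcm_set D x y \<longleftrightarrow> r \<in> carrier D \<and> (\<forall>v\<in>V. r v \<in> lcm_set (P v) (x v) (y v))"
proof
  assume r: "r \<in> carrier D \<and> (\<forall>v\<in>V. r v \<in> lcm_set (P v) (x v) (y v))"
  then have rD: "r \<in> carrier D" ..
  have ideal: "z v \<in> r v <#\<^bsub>P v\<^esub> carrier (P v) \<longleftrightarrow>
      z v \<in> x v <#\<^bsub>P v\<^esub> carrier (P v) \<and> z v \<in> y v <#\<^bsub>P v\<^esub> carrier (P v)" if "v \<in> V" for v z
  proof -
    have "r v \<in> lcm_set (P v) (x v) (y v)" using r that by blast
    then show ?thesis unfolding lcm_set_def by blast
  qed
  have "(x <#\<^bsub>D\<^esub> carrier D) \<inter> (y <#\<^bsub>D\<^esub> carrier D) = r <#\<^bsub>D\<^esub> carrier D"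
    by (rule Set.set_eqI) (auto simp: direct_sum_mem_ideal_iff x y rD ideal)
  then show "r \<in> lcm_set D x y" using rD unfolding lcm_set_def by blast
next
  assume r: "r \<in> lcm_set D x y"
  note rD = dsum.lcm_setD[OF r]
  have "r v \<in> lcm_set (P v) (x v) (y v)" if v: "v \<in> V" for v
  proof -
    interpret Pv: left_cancellative_monoid "P v" by (rule summand_left_cancellative[OF v])
    have rx: "r v \<in> x v <#\<^bsub>P v\<^esub> carrier (P v)" and ry: "r v \<in> y v <#\<^bsub>P v\<^esub> carrier (P v)"
      using rD v direct_sum_mem_ideal_iff[OF x] direct_sum_mem_ideal_iff[OF y] by auto
    have xc: "x v \<in> carrier (P v)" and yc: "y v \<in> carrier (P v)" and rc: "r v \<in> carrier (P v)"
      using direct_sum_component x y rD(1) v by auto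
    have sub: "r v <#\<^bsub>P v\<^esub> carrier (P v) \<subseteq> a <#\<^bsub>P v\<^esub> carrier (P v)"
      if a: "a \<in> carrier (P v)" "r v \<in> a <#\<^bsub>P v\<^esub> carrier (P v)" for a
    proof
      fix b assume "b \<in> r v <#\<^bsub>P v\<^esub> carrier (P v)"
      then obtain c where c: "c \<in> carrier (P v)" "b = r v \<otimes>\<^bsub>P v\<^esub> c"
        by (auto simp: Pv.mem_ideal_iff)
      obtain d where d: "d \<in> carrier (P v)" "r v = a \<otimes>\<^bsub>P v\<^esub> d"
        using a by (auto simp: Pv.mem_ideal_iff)
      then have "b = a \<otimes>\<^bsub>P v\<^esub> (d \<otimes>\<^bsub>P v\<^esub> c)" using a c by (simp add: Pv.m_assoc)
      then show "b \<in> a <#\<^bsub>P v\<^esub> carrier (P v)" using c d Pv.mem_ideal_iff by blast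
    qed
    have "t \<in> r v <#\<^bsub>P v\<^esub> carrier (P v)"
      if tx: "t \<in> x v <#\<^bsub>P v\<^esub> carrier (P v)" and ty: "t \<in> y v <#\<^bsub>P v\<^esub> carrier (P v)" for t
    proof -
      have t: "t \<in> carrier (P v)" using tx xc by (auto simp: Pv.mem_ideal_iff)
      have upd: "r(v := t) \<in> carrier D" by (rule direct_sum_update[OF rD(1) v t])
      have "r(v := t) \<in> (x <#\<^bsub>D\<^esub> carrier D) \<inter> (y <#\<^bsub>D\<^esub> carrier D)"
        using upd tx ty rD(2,3) unfolding Int_iff direct_sum_mem_ideal_iff[OF x]
          direct_sum_mem_ideal_iff[OF y] by auto
      then have "r(v := t) \<in> r <#\<^bsub>D\<^esub> carrier D" using r unfolding lcm_set_def by blast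
      then show ?thesis using v direct_sum_mem_ideal_iff[OF rD(1)] by force
    qed
    then show ?thesis
      unfolding lcm_set_def using sub[OF xc rx] sub[OF yc ry] rc by blast
  qed
  then show "r \<in> carrier D \<and> (\<forall>v\<in>V. r v \<in> lcm_set (P v) (x v) (y v))" using rD by blast
qed

lemma summand_embedding_eq: "v \<in> V \<Longrightarrow> summand_embedding V P v p = \<one>\<^bsub>D\<^esub>(v := p)"
  by (auto simp: summand_embedding_def direct_sum_one)

lemma summand_embedding_closed:
  "v \<in> V \<Longrightarrow> p \<in> carrier (P v) \<Longrightarrow> summand_embedding V P v p \<in> carrier D"
  by (simp add: summand_embedding_eq direct_sum_update)

lemma direct_sum_update_eq_mult:
  assumes x: "x \<in> carrier D" "x v = \<one>\<^bsub>P v\<^esub>" and v: "v \<in> V" "p \<in> carrier (P v)"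
  shows "x(v := p) = x \<otimes>\<^bsub>D\<^esub> summand_embedding V P v p"
proof (rule direct_sum_ext)
  show "x(v := p) \<in> carrier D" by (rule direct_sum_update[OF x(1) v])
  show "x \<otimes>\<^bsub>D\<^esub> summand_embedding V P v p \<in> carrier D"
    using x v summand_embedding_closed by simp
  fix w assume "w \<in> V"
  then show "(x(v := p)) w = (x \<otimes>\<^bsub>D\<^esub> summand_embedding V P v p) w"
    using x v summand_monoid direct_sum_component[OF x(1)]
    by (auto simp: direct_sum_mult summand_embedding_def monoid.l_one monoid.r_one)
qed

end

section \<open>Doubly commuting representations\<close>

locale doubly_commuting_rep = right_lcm_family V P
  for V :: "'v set" and P :: "'v \<Rightarrow> ('a, 'm) monoid_scheme" +
  fixes T :: "('v \<Rightarrow> 'a) \<Rightarrow> 'h::complex_hilbert_space \<Rightarrow>\<^sub>L 'h"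
  assumes direct_sum_rep: "unital_contractive_rep (direct_sum_monoid V P) T"
    and doubly_commuting: "doubly_commuting V P T"
begin

sublocale drep: contractive_rep D T
  by unfold_locales (rule direct_sum_rep)

section \<open>Restrictions to summands and their commutation relations\<close>

abbreviation S where "S \<equiv> summand_restriction V P T"

lemma summand_contractive_rep:
  assumes v: "v \<in> V"
  shows "contractive_rep (P v) (S v)"
proof -
  interpret Pv: left_cancellative_monoid "P v" by (rule summand_left_cancellative[OF v])
  have "summand_embedding V P v \<one>\<^bsub>P v\<^esub> = \<one>\<^bsub>D\<^esub>"
    using v by (auto simp: summand_embedding_def direct_sum_one)
  moreover have "summand_embedding V P v (p \<otimes>\<^bsub>P v\<^esub> q) =
      summand_embedding V P v p \<otimes>\<^bsub>D\<^esub> summand_embedding V P v q" for p q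
    using summand_monoid by (auto simp: summand_embedding_def direct_sum_mult monoid.l_one monoid.one_closed)
  ultimately have "unital_contractive_rep (P v) (S v)"
    unfolding unital_contractive_rep_def summand_restriction_def
    using v summand_embedding_closed drep.rep_clinear drep.rep_norm drep.rep_one drep.rep_mult by simp
  then show ?thesis by unfold_locales
qed

lemma rep_update:
  assumes "x \<in> carrier D" "x v = \<one>\<^bsub>P v\<^esub>" "v \<in> V" "p \<in> carrier (P v)"
  shows "T (x(v := p)) = T x o\<^sub>L S v p"
  using assms summand_embedding_closed
  by (simp add: direct_sum_update_eq_mult drep.rep_mult summand_restriction_def)

text \<open>\<open>T x\<close> is a finite product over the nontrivial coordinates of
  \<open>x\<close>, peeled off by induction on the support. An arbitrary \<open>A\<close> covers
  both \<open>S v p\<close> and its adjoint.\<close>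

lemma commuting_ops_direct_sum:
  assumes "x \<in> carrier D"
    and "\<And>w. w \<in> V \<Longrightarrow> x w \<noteq> \<one>\<^bsub>P w\<^esub> \<Longrightarrow> commuting_ops (S w (x w)) A"
  shows "commuting_ops (T x) A"
proof -
  have "finite {w \<in> V. x w \<noteq> \<one>\<^bsub>P w\<^esub>}" using assms(1) by (simp add: mem_direct_sum_iff)
  then show ?thesis
    using assms
  proof (induction "{w \<in> V. x w \<noteq> \<one>\<^bsub>P w\<^esub>}" arbitrary: x rule: finite_induct)
    case empty
    then have "x = \<one>\<^bsub>D\<^esub>"
      by (intro direct_sum_ext[OF _ dsum.one_closed]) (auto simp: direct_sum_one)
    then show ?case by (simp add: drep.rep_one commuting_ops_apply)
  next
    case (insert v F)
    define y where "y = x(v := \<one>\<^bsub>P v\<^esub>)"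
    have v: "v \<in> V" using insert by blast
    have y: "y \<in> carrier D" "y v = \<one>\<^bsub>P v\<^esub>"
      unfolding y_def using insert.prems v monoid.one_closed[OF summand_monoid[OF v]]
      by (auto intro: direct_sum_update)
    have "F = {w \<in> V. y w \<noteq> \<one>\<^bsub>P w\<^esub>}" using insert.hyps(2,4) by (auto simp: y_def)
    then have "commuting_ops (T y) A"
      using y(1) insert.prems(2) by (intro insert.hyps(3)) (auto simp: y_def split: if_splits)
    moreover have "y(v := x v) = x" by (auto simp: y_def)
    then have "T x = T y o\<^sub>L S v (x v)"
      using rep_update[OF y v, of "x v"] direct_sum_component[OF insert.prems(1) v] by simp
    moreover have "commuting_ops (S v (x v)) A"
      using insert.prems(2)[OF v] insert.hyps(4) by blast
    ultimately show ?case by (simp add: commuting_ops_compose)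
  qed
qed

text \<open>The nontrivial coordinates of \<open>x\<close> sit at indices other than
  \<open>v\<close>, where double commutation applies. Adjoints of the first two relations give the
  last two.\<close>

lemma commuting_ops_complement:
  assumes v: "v \<in> V" and x: "x \<in> carrier D" "x v = \<one>\<^bsub>P v\<^esub>" and p: "p \<in> carrier (P v)"
  shows "commuting_ops (T x) (S v p)" "commuting_ops (T x) (adjoint_op (S v p))"
    "commuting_ops (adjoint_op (T x)) (S v p)"
    "commuting_ops (adjoint_op (T x)) (adjoint_op (S v p))"
proof -
  have dc: "commuting_ops (S w (x w)) (S v p)" "commuting_ops (S w (x w)) (adjoint_op (S v p))"
    if "w \<in> V" "x w \<noteq> \<one>\<^bsub>P w\<^esub>" for w
  proof -
    have "w \<noteq> v" using that x by auto
    then show "commuting_ops (S w (x w)) (S v p)" "commuting_ops (S w (x w)) (adjoint_op (S v p))"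
      using doubly_commuting v p that direct_sum_component[OF x(1)]
      unfolding doubly_commuting_def by blast+
  qed
  show *: "commuting_ops (T x) (S v p)" "commuting_ops (T x) (adjoint_op (S v p))"
    using x(1) dc by (auto intro: commuting_ops_direct_sum)
  have cl: "clinear_op (T x)" "clinear_op (S v p)"
    using x p v summand_embedding_closed drep.rep_clinear by (auto simp: summand_restriction_def)
  show "commuting_ops (adjoint_op (T x)) (S v p)"
    using commuting_ops_adjoint_swap[OF cl *(2)] by (rule commuting_ops_sym)
  show "commuting_ops (adjoint_op (T x)) (adjoint_op (S v p))"
    by (rule commuting_ops_adjoint[OF cl *(1)])
qed

text \<open>A least common multiple may carry a nontrivial unit at \<open>v\<close>. Resetting that
  coordinate to the identity keeps it a least common multiple and makes both quotients trivial at
  \<open>v\<close>.\<close>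

lemma regular_kernel_complement_cases:
  assumes v: "v \<in> V" and x: "x \<in> carrier D" "x v = \<one>\<^bsub>P v\<^esub>" and y: "y \<in> carrier D" "y v = \<one>\<^bsub>P v\<^esub>"
  obtains "lcm_set D x y = {}" "regular_kernel D T x y = 0"
  | r where "r \<in> lcm_set D x y" "r v = \<one>\<^bsub>P v\<^esub>"
      "left_quotient D x r \<in> carrier D" "left_quotient D x r v = \<one>\<^bsub>P v\<^esub>"
      "left_quotient D y r \<in> carrier D" "left_quotient D y r v = \<one>\<^bsub>P v\<^esub>"
      "regular_kernel D T x y = T (left_quotient D x r) o\<^sub>L adjoint_op (T (left_quotient D y r))"
  using x(1) y(1)
proof (cases rule: drep.regular_kernel_cases)
  case 1
  then show ?thesis using that(1) by blast
next
  case (2 s)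
  interpret Pv: left_cancellative_monoid "P v" by (rule summand_left_cancellative[OF v])
  define r where "r = s(v := \<one>\<^bsub>P v\<^esub>)"
  have r: "r \<in> lcm_set D x y"
    using 2(1) v x y Pv.lcm_set_one
    unfolding r_def direct_sum_mem_lcm_set_iff[OF x(1) y(1)] by (auto intro: direct_sum_update)
  note rD = dsum.lcm_setD[OF r]
  have rv: "r v = \<one>\<^bsub>P v\<^esub>" by (simp add: r_def)
  show ?thesis
  proof (rule that(2)[OF r rv])
    show "left_quotient D x r \<in> carrier D" "left_quotient D y r \<in> carrier D"
      using x y rD dsum.left_quotient_closed by auto
    show "left_quotient D x r v = \<one>\<^bsub>P v\<^esub>" "left_quotient D y r v = \<one>\<^bsub>P v\<^esub>"
      using x y rD v rv Pv.left_quotient_self by (simp_all add: direct_sum_left_quotient)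
    show "regular_kernel D T x y = T (left_quotient D x r) o\<^sub>L adjoint_op (T (left_quotient D y r))"
      by (rule drep.regular_kernel_eq[OF x(1) y(1) r])
  qed
qed

text \<open>The factorisation of the kernel, one coordinate at a time. With quotients
  \<open>a\<close>, \<open>b\<close> off \<open>v\<close> and \<open>c\<close>, \<open>d\<close> at
  \<open>v\<close>, the operator is T a S c (T b S d)^*, and the adjoint of \<open>T b\<close>
  commutes with both factors at \<open>v\<close>. If the left \<open>lcm_set\<close> is empty, one
  factor on the right vanishes.\<close>

lemma regular_kernel_update:
  assumes v: "v \<in> V" and x: "x \<in> carrier D" "x v = \<one>\<^bsub>P v\<^esub>" and y: "y \<in> carrier D" "y v = \<one>\<^bsub>P v\<^esub>"
    and p: "p \<in> carrier (P v)" and q: "q \<in> carrier (P v)"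
  shows "regular_kernel D T (x(v := p)) (y(v := q)) =
    regular_kernel D T x y o\<^sub>L regular_kernel (P v) (S v) p q"
proof -
  interpret R: contractive_rep "P v" "S v" by (rule summand_contractive_rep[OF v])
  have xp: "x(v := p) \<in> carrier D" and yq: "y(v := q) \<in> carrier D"
    using direct_sum_update v x y p q by auto
  show ?thesis
  proof (cases "lcm_set D (x(v := p)) (y(v := q)) = {}")
    case True
    have "lcm_set D x y = {} \<or> lcm_set (P v) p q = {}"
    proof (rule ccontr)
      \<comment> \<open>Gluing \<open>s\<close> at \<open>v\<close> with \<open>r\<close> elsewhere
        would give an element of the empty \<open>lcm_set\<close>.\<close>
      assume "\<not> (lcm_set D x y = {} \<or> lcm_set (P v) p q = {})"
      then obtain r s where "r \<in> lcm_set D x y" "s \<in> lcm_set (P v) p q" by blast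
      then have "r(v := s) \<in> lcm_set D (x(v := p)) (y(v := q))"
        using v R.lcm_setD(1) unfolding direct_sum_mem_lcm_set_iff[OF xp yq]
          direct_sum_mem_lcm_set_iff[OF x(1) y(1)]
        by (auto intro: direct_sum_update)
      with True show False by blast
    qed
    then have "regular_kernel D T x y = 0 \<or> regular_kernel (P v) (S v) p q = 0"
      by (auto simp: regular_kernel_def)
    with True show ?thesis
      by (auto simp: regular_kernel_def[of D T "x(v := p)"] intro!: blinfun_eqI)
  next
    case False
    then obtain t where t: "t \<in> lcm_set D (x(v := p)) (y(v := q))" by blast
    then have tv: "t v \<in> lcm_set (P v) p q" and tD: "t \<in> carrier D"
      and tw: "\<And>w. w \<in> V \<Longrightarrow> w \<noteq> v \<Longrightarrow> t w \<in> lcm_set (P w) (x w) (y w)"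
      using v unfolding direct_sum_mem_lcm_set_iff[OF xp yq] by (auto split: if_splits)
    \<comment> \<open>This excludes the first alternative of
      \<open>regular_kernel_complement_cases\<close>, so an \<open>r\<close> that is trivial at
      \<open>v\<close> can be chosen.\<close>
    have "t(v := \<one>\<^bsub>P v\<^esub>) \<in> lcm_set D x y"
      using tD tw v x y R.lcm_set_one unfolding direct_sum_mem_lcm_set_iff[OF x(1) y(1)]
      by (auto intro: direct_sum_update)
    then have "lcm_set D x y \<noteq> {}" by blast
    with v x y obtain r where r: "r \<in> lcm_set D x y" "r v = \<one>\<^bsub>P v\<^esub>"
      "left_quotient D x r \<in> carrier D" "left_quotient D x r v = \<one>\<^bsub>P v\<^esub>"
      "left_quotient D y r \<in> carrier D" "left_quotient D y r v = \<one>\<^bsub>P v\<^esub>"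
      "regular_kernel D T x y = T (left_quotient D x r) o\<^sub>L adjoint_op (T (left_quotient D y r))"
      by (cases rule: regular_kernel_complement_cases) auto
    define s where "s = t v"
    have s: "s \<in> lcm_set (P v) p q" using tv by (simp add: s_def)
    note sD = R.lcm_setD[OF s]
    define a where "a = left_quotient D x r"
    define b where "b = left_quotient D y r"
    define c where "c = left_quotient (P v) p s"
    define d where "d = left_quotient (P v) q s"
    have c: "c \<in> carrier (P v)" and d: "d \<in> carrier (P v)"
      using p q sD R.left_quotient_closed by (auto simp: c_def d_def)
    have ab: "a \<in> carrier D" "a v = \<one>\<^bsub>P v\<^esub>" "b \<in> carrier D" "b v = \<one>\<^bsub>P v\<^esub>"
      using r by (auto simp: a_def b_def)
    have rs: "r(v := s) \<in> lcm_set D (x(v := p)) (y(v := q))"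
      using r(1) s sD(1) v unfolding direct_sum_mem_lcm_set_iff[OF xp yq]
        direct_sum_mem_lcm_set_iff[OF x(1) y(1)]
      by (auto intro: direct_sum_update)
    have qx: "left_quotient D (x(v := p)) (r(v := s)) = a(v := c)"
    proof (rule direct_sum_ext)
      fix w assume "w \<in> V"
      then show "left_quotient D (x(v := p)) (r(v := s)) w = (a(v := c)) w"
        using dsum.lcm_setD[OF rs] dsum.lcm_setD[OF r(1)] xp x(1)
        by (simp add: direct_sum_left_quotient a_def c_def)
    qed (use dsum.lcm_setD[OF rs] xp dsum.left_quotient_closed direct_sum_update ab c v in auto)
    have qy: "left_quotient D (y(v := q)) (r(v := s)) = b(v := d)"
    proof (rule direct_sum_ext)
      fix w assume "w \<in> V"
      then show "left_quotient D (y(v := q)) (r(v := s)) w = (b(v := d)) w"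
        using dsum.lcm_setD[OF rs] dsum.lcm_setD[OF r(1)] yq y(1)
        by (simp add: direct_sum_left_quotient b_def d_def)
    qed (use dsum.lcm_setD[OF rs] yq dsum.left_quotient_closed direct_sum_update ab d v in auto)
    have "regular_kernel D T (x(v := p)) (y(v := q)) = T (a(v := c)) o\<^sub>L adjoint_op (T (b(v := d)))"
      using drep.regular_kernel_eq[OF xp yq rs] by (simp add: qx qy)
    also have "\<dots> = (T a o\<^sub>L S v c) o\<^sub>L (adjoint_op (S v d) o\<^sub>L adjoint_op (T b))"
      using ab c d v
      by (simp add: rep_update adjoint_op_compose drep.rep_clinear R.rep_clinear)
    \<comment> \<open>\<open>adjoint_op (T b)\<close> moves left past
      \<open>adjoint_op (S v d)\<close> and then \<open>S v c\<close>.\<close>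
    also have "\<dots> = (T a o\<^sub>L adjoint_op (T b)) o\<^sub>L (S v c o\<^sub>L adjoint_op (S v d))"
      using commuting_ops_complement(3,4)[OF v ab(3,4)] c d
      by (intro blinfun_eqI) (simp add: commuting_ops_apply)
    also have "T a o\<^sub>L adjoint_op (T b) = regular_kernel D T x y"
      using r(7) by (simp add: a_def b_def)
    also have "S v c o\<^sub>L adjoint_op (S v d) = regular_kernel (P v) (S v) p q"
      using R.regular_kernel_eq[OF p q s] by (simp add: c_def d_def)
    finally show ?thesis .
  qed
qed

text \<open>Each factor of the kernel off \<open>v\<close> commutes with each factor at
  \<open>v\<close>. This provides the commutation hypothesis of
  \<open>mat_schur_nonneg\<close>.\<close>

lemma regular_kernel_commute:
  assumes v: "v \<in> V" and x: "x \<in> carrier D" "x v = \<one>\<^bsub>P v\<^esub>" and y: "y \<in> carrier D" "y v = \<one>\<^bsub>P v\<^esub>"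
    and p: "p \<in> carrier (P v)" and q: "q \<in> carrier (P v)"
  shows "regular_kernel D T x y (regular_kernel (P v) (S v) p q h) =
    regular_kernel (P v) (S v) p q (regular_kernel D T x y h)"
proof -
  interpret R: contractive_rep "P v" "S v" by (rule summand_contractive_rep[OF v])
  show ?thesis
    using v x y
  proof (cases rule: regular_kernel_complement_cases)
    case 1
    then show ?thesis by simp
  next
    case r: (2 r)
    from p q show ?thesis
    proof (cases rule: R.regular_kernel_cases)
      case 1
      then show ?thesis by simp
    next
      case (2 s)
      note comm = commuting_ops_complement[OF v, unfolded commuting_ops_apply, rule_format]
      show ?thesis
        by (simp add: r(7) 2(4) comm r(3-6) 2(2,3))
    qed
  qed
qed

lemma regular_kernel_one: "regular_kernel D T \<one>\<^bsub>D\<^esub> \<one>\<^bsub>D\<^esub> = id_blinfun"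
  using drep.regular_kernel_eq[OF _ _ dsum.lcm_set_one]
  by (simp add: dsum.left_quotient_self drep.rep_one adjoint_op_id blinfun_eqI)

text \<open>The case \<open>x = y = \<one>\<close> of \<open>regular_kernel_update\<close>, where
  the complementary factor is \<open>id_blinfun\<close>.\<close>

lemma regular_kernel_summand:
  assumes "v \<in> V" "p \<in> carrier (P v)" "q \<in> carrier (P v)"
  shows "regular_kernel (P v) (S v) p q =
    regular_kernel D T (summand_embedding V P v p) (summand_embedding V P v q)"
  using assms regular_kernel_update[of v "\<one>\<^bsub>D\<^esub>" "\<one>\<^bsub>D\<^esub>" p q]
  by (simp add: summand_embedding_eq regular_kernel_one) (simp add: direct_sum_one blinfun_eqI)

section \<open>Induction over finite sets of coordinates\<close>

definition restrict_to :: "'v set \<Rightarrow> ('v \<Rightarrow> 'a) \<Rightarrow> 'v \<Rightarrow> 'a" where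
  "restrict_to F x = (\<lambda>v\<in>V. if v \<in> F then x v else \<one>\<^bsub>P v\<^esub>)"

lemma restrict_to_closed:
  assumes "x \<in> carrier D"
  shows "restrict_to F x \<in> carrier D"
proof -
  have "{v \<in> V. restrict_to F x v \<noteq> \<one>\<^bsub>P v\<^esub>} \<subseteq> {v \<in> V. x v \<noteq> \<one>\<^bsub>P v\<^esub>}"
    by (auto simp: restrict_to_def)
  then have "finite {v \<in> V. restrict_to F x v \<noteq> \<one>\<^bsub>P v\<^esub>}"
    by (rule finite_subset) (use assms in \<open>simp add: mem_direct_sum_iff\<close>)
  then show ?thesis
    using assms monoid.one_closed[OF summand_monoid]
    by (auto simp: mem_direct_sum_iff restrict_to_def)
qed

text \<open>Induction on \<open>F\<close>: adding \<open>v\<close> multiplies the kernel matrix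
  entrywise by the one of \<open>S v\<close>, so \<open>mat_schur_nonneg\<close> applies.\<close>

lemma regular_kernel_restrict_nonneg:
  fixes n :: nat
  assumes S: "\<And>v. v \<in> V \<Longrightarrow> has_star_regular_dilation (P v) (S v)"
    and p: "\<And>i. i < n \<Longrightarrow> p i \<in> carrier D"
    and F: "finite F" "F \<subseteq> V"
  shows "mat_nonneg {..<n} (\<lambda>i j. regular_kernel D T (restrict_to F (p i)) (restrict_to F (p j)))"
  using F
proof (induction F rule: finite_induct)
  case empty
  \<comment> \<open>For empty \<open>F\<close> all entries are \<open>id_blinfun\<close>, and the
    form is the squared norm of the sum of the vectors.\<close>
  have "restrict_to {} x = \<one>\<^bsub>D\<^esub>" for x by (simp add: restrict_to_def direct_sum_one)
  moreover have "vec_inner {..<n} (mat_vec {..<n} (\<lambda>i j. id_blinfun) h) h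
      = inner (\<Sum>j<n. h j) (\<Sum>i<n. h i)" for h :: "nat \<Rightarrow> 'h"
    unfolding vec_inner_def mat_vec_def inner_sum_right[symmetric] by simp
  ultimately show ?case
    by (simp add: mat_nonneg_def regular_kernel_one)
next
  case (insert v F)
  then have v: "v \<in> V" by blast
  interpret R: contractive_rep "P v" "S v" by (rule summand_contractive_rep[OF v])
  define A where "A i j = regular_kernel D T (restrict_to F (p i)) (restrict_to F (p j))" for i j
  define B where "B i j = regular_kernel (P v) (S v) (p i v) (p j v)" for i j
  have pv: "p i v \<in> carrier (P v)" if "i < n" for i
    using direct_sum_component[OF p[OF that] v] .
  have res: "restrict_to F (p i) \<in> carrier D" "restrict_to F (p i) v = \<one>\<^bsub>P v\<^esub>" if "i < n" for i
    using restrict_to_closed[OF p[OF that]] insert.hyps v by (auto simp: restrict_to_def)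
  have "mat_nonneg {..<n} (mat_schur A B)"
  proof (rule mat_schur_nonneg)
    show "mat_nonneg {..<n} A" using insert unfolding A_def by blast
    show "mat_symmetric {..<n} B"
      unfolding B_def using pv by (intro R.regular_kernel_mat_symmetric) simp
    show "mat_nonneg {..<n} B"
      unfolding B_def
      by (rule R.star_regular_dilation_mat_nonneg[OF S[OF v], of n "\<lambda>i. p i v"]) (rule pv)
    show "A i j (B k l x) = B k l (A i j x)"
      if "i \<in> {..<n}" "j \<in> {..<n}" "k \<in> {..<n}" "l \<in> {..<n}" for i j k l x
      unfolding A_def B_def using that v res pv by (intro regular_kernel_commute) auto
  qed simp
  also have "mat_nonneg {..<n} (mat_schur A B) \<longleftrightarrow> mat_nonneg {..<n}
      (\<lambda>i j. regular_kernel D T (restrict_to (insert v F) (p i)) (restrict_to (insert v F) (p j)))"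
  proof (rule mat_nonneg_cong)
    have upd: "restrict_to (insert v F) x = (restrict_to F x)(v := x v)" for x
      using v by (auto simp: restrict_to_def)
    fix i j assume "i \<in> {..<n}" "j \<in> {..<n}"
    then show "mat_schur A B i j =
        regular_kernel D T (restrict_to (insert v F) (p i)) (restrict_to (insert v F) (p j))"
      unfolding upd mat_schur_def A_def B_def
      using v res pv by (intro regular_kernel_update[symmetric]) auto
  qed
  finally show ?case .
qed

lemma star_regular_dilation_direct_sum_iff:
  "has_star_regular_dilation D T \<longleftrightarrow> (\<forall>v\<in>V. has_star_regular_dilation (P v) (S v))"
proof
  assume D: "has_star_regular_dilation D T"
  show "\<forall>v\<in>V. has_star_regular_dilation (P v) (S v)"
  proof
    fix v assume v: "v \<in> V"
    interpret R: contractive_rep "P v" "S v" by (rule summand_contractive_rep[OF v])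
    show "has_star_regular_dilation (P v) (S v)"
      unfolding R.star_regular_dilation_iff
    proof (intro allI impI)
      fix n :: nat and p assume p: "\<forall>i<n. p i \<in> carrier (P v)"
      have "mat_nonneg {..<n} (\<lambda>i j. regular_kernel D T
          (summand_embedding V P v (p i)) (summand_embedding V P v (p j)))"
        by (rule drep.star_regular_dilation_mat_nonneg[OF D, of n "\<lambda>i. summand_embedding V P v (p i)"])
          (use p v summand_embedding_closed in blast)
      also have "mat_nonneg {..<n} (\<lambda>i j. regular_kernel D T
          (summand_embedding V P v (p i)) (summand_embedding V P v (p j))) \<longleftrightarrow>
          mat_nonneg {..<n} (\<lambda>i j. regular_kernel (P v) (S v) (p i) (p j))"
        by (rule mat_nonneg_cong) (use p v in \<open>simp add: regular_kernel_summand\<close>)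
      finally show "mat_nonneg {..<n} (\<lambda>i j. regular_kernel (P v) (S v) (p i) (p j))" .
    qed
  qed
next
  assume S: "\<forall>v\<in>V. has_star_regular_dilation (P v) (S v)"
  show "has_star_regular_dilation D T"
    unfolding drep.star_regular_dilation_iff
  proof (intro allI impI)
    fix n :: nat and p assume p: "\<forall>i<n. p i \<in> carrier D"
    \<comment> \<open>The joint support of the finitely many elements; restricting them to it
      changes nothing.\<close>
    define F where "F = (\<Union>i<n. {v \<in> V. p i v \<noteq> \<one>\<^bsub>P v\<^esub>})"
    have F: "finite F" "F \<subseteq> V" using p by (auto simp: F_def mem_direct_sum_iff)
    have p_eq: "restrict_to F (p i) = p i" if "i < n" for i
    proof (rule direct_sum_ext)
      show "restrict_to F (p i) v = p i v" if "v \<in> V" for v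
        using that \<open>i < n\<close> by (auto simp: restrict_to_def F_def)
    qed (use p that restrict_to_closed in auto)
    have "mat_nonneg {..<n} (\<lambda>i j. regular_kernel D T (restrict_to F (p i)) (restrict_to F (p j)))"
      using S p F by (intro regular_kernel_restrict_nonneg) auto
    also have "mat_nonneg {..<n} (\<lambda>i j. regular_kernel D T (restrict_to F (p i)) (restrict_to F (p j)))
        \<longleftrightarrow> mat_nonneg {..<n} (\<lambda>i j. regular_kernel D T (p i) (p j))"
      by (rule mat_nonneg_cong) (simp add: p_eq)
    finally show "mat_nonneg {..<n} (\<lambda>i j. regular_kernel D T (p i) (p j))" .
  qed
qed

end

theorem theorem6p11:
  fixes V :: "'v set"
    and P :: "'v \<Rightarrow> ('a, 'm) monoid_scheme"
    and T :: "('v \<Rightarrow> 'a) \<Rightarrow> ('h::complex_hilbert_space \<Rightarrow>\<^sub>L 'h)"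
  assumes "countable V"
    and "\<And>v. v \<in> V \<Longrightarrow> right_lcm_semigroup (P v)"
    and "unital_contractive_rep (direct_sum_monoid V P) T"
    and "doubly_commuting V P T"
  shows "has_star_regular_dilation (direct_sum_monoid V P) T \<longleftrightarrow>
         (\<forall>v\<in>V. has_star_regular_dilation (P v) (summand_restriction V P T v))"
proof -
  interpret doubly_commuting_rep V P T
    by (intro doubly_commuting_rep.intro right_lcm_family.intro doubly_commuting_rep_axioms.intro
        assms)
  show ?thesis by (rule star_regular_dilation_direct_sum_iff)
qed

end
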